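(* Let $(M,\eta,\xi,\phi,g)$ be a 3-dimensional contact metric structure that is strict generalized Eta-Einstein, i.e. its Ricci operator satisfies $QX=\lambda X+\gamma\,\eta(X)\xi$ for all tangent vectors $X$, where $\lambda,\gamma$ are smooth functions on $M$ that are not both constant. Then $(M,\eta,\xi,\phi,g)$ is K-contact.
   Context: Manifolds are connected. A contact form on a $(2n+1)$-dimensional manifold $M$ ($n\ge 1$) is a 1-form $\eta$ such that $\eta\wedge(d\eta)^n$ is a volume form. A contact metric structure $(M,\eta,\xi,\phi,g)$ consists of a contact form $\eta$, a vector field $\xi$ (the Reeb field, a unit field), an endomorphism field $\phi$ of $TM$ and a Riemannian metric $g$ with $\eta(\xi)=1$, $\phi^2=-\mathrm{Id}+\eta\otimes\xi$, $\phi\xi=0$ and $d\eta(X,Y)=2g(X,\phi Y)$, where $d\eta(X,Y)=X\eta(Y)-Y\eta(X)-\eta([X,Y])$. The structure is K-contact if $\xi$ is a Killing vector field of $g$. $Q$ is the Ricci operator: $\mathrm{Ric}(X,Y)=g(QX,Y)$. *)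

theory Defs
  imports "HOL-Analysis.Analysis"
begin

section \<open>Smooth maps on open subsets of Euclidean space\<close>

primrec Ck_on :: "nat \<Rightarrow> 'e::euclidean_space set \<Rightarrow> ('e \<Rightarrow> 'b::real_normed_vector) \<Rightarrow> bool" where
  "Ck_on 0 S f \<longleftrightarrow> continuous_on S f"
| "Ck_on (Suc k) S f \<longleftrightarrow>
     (\<forall>x\<in>S. f differentiable (at x)) \<and> (\<forall>v. Ck_on k S (\<lambda>x. frechet_derivative f (at x) v))"

text \<open>Only applied to open sets, where \<^term>\<open>at x\<close> looks at \<^term>\<open>f\<close> inside the set only.\<close>

definition smooth_on :: "'e::euclidean_space set \<Rightarrow> ('e \<Rightarrow> 'b::real_normed_vector) \<Rightarrow> bool" where
  "smooth_on S f \<longleftrightarrow> (\<forall>k. Ck_on k S f)"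


section \<open>Tensor calculus on open subsets of Euclidean space\<close>

text \<open>On an open subset of the vector space \<^typ>\<open>'e\<close>, a vector field is a map \<^typ>\<open>'e \<Rightarrow> 'e\<close>, a
  1-form a map \<^typ>\<open>'e \<Rightarrow> 'e \<Rightarrow> real\<close> and a metric a map \<^typ>\<open>'e \<Rightarrow> 'e \<Rightarrow> 'e \<Rightarrow> real\<close>, the base point
  being the first argument. These are used below for the coordinate representations of tensor
  fields; a vector \<^term>\<open>w\<close> extends to the coordinate (constant) vector field \<^term>\<open>\<lambda>_. w\<close>.\<close>

definition lie_bracket :: "('e::euclidean_space \<Rightarrow> 'e) \<Rightarrow> ('e \<Rightarrow> 'e) \<Rightarrow> 'e \<Rightarrow> 'e" where
  "lie_bracket X Y x = frechet_derivative Y (at x) (X x) - frechet_derivative X (at x) (Y x)"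

text \<open>\<open>d\<alpha>(X,Y) = X \<alpha>(Y) - Y \<alpha>(X) - \<alpha>([X,Y])\<close>\<close>

definition ext_deriv ::
  "('e::euclidean_space \<Rightarrow> 'e \<Rightarrow> real) \<Rightarrow> ('e \<Rightarrow> 'e) \<Rightarrow> ('e \<Rightarrow> 'e) \<Rightarrow> 'e \<Rightarrow> real" where
  "ext_deriv \<alpha> X Y x =
     frechet_derivative (\<lambda>y. \<alpha> y (Y y)) (at x) (X x)
   - frechet_derivative (\<lambda>y. \<alpha> y (X y)) (at x) (Y x)
   - \<alpha> x (lie_bracket X Y x)"

text \<open>\<open>(L\<^sub>V g)(X,Y) = V g(X,Y) - g([V,X],Y) - g(X,[V,Y])\<close>\<close>

definition lie_deriv_metric ::
  "('e::euclidean_space \<Rightarrow> 'e) \<Rightarrow> ('e \<Rightarrow> 'e \<Rightarrow> 'e \<Rightarrow> real) \<Rightarrow> ('e \<Rightarrow> 'e) \<Rightarrow> ('e \<Rightarrow> 'e) \<Rightarrow> 'e \<Rightarrow> real" where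
  "lie_deriv_metric V G X Y x =
     frechet_derivative (\<lambda>y. G y (X y) (Y y)) (at x) (V x)
   - G x (lie_bracket V X x) (Y x)
   - G x (X x) (lie_bracket V Y x)"

definition koszul ::
  "('e::euclidean_space \<Rightarrow> 'e \<Rightarrow> 'e \<Rightarrow> real) \<Rightarrow> ('e \<Rightarrow> 'e) \<Rightarrow> ('e \<Rightarrow> 'e) \<Rightarrow> ('e \<Rightarrow> 'e) \<Rightarrow> 'e \<Rightarrow> real" where
  "koszul G X Y Z x =
     frechet_derivative (\<lambda>y. G y (Y y) (Z y)) (at x) (X x)
   + frechet_derivative (\<lambda>y. G y (X y) (Z y)) (at x) (Y x)
   - frechet_derivative (\<lambda>y. G y (X y) (Y y)) (at x) (Z x)
   + G x (lie_bracket X Y x) (Z x)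
   - G x (lie_bracket X Z x) (Y x)
   - G x (lie_bracket Y Z x) (X x)"

text \<open>The Levi-Civita connection: \<open>2 g(\<nabla>\<^sub>X Y, Z)\<close> is given by the Koszul formula. The right-hand side
  is tensorial in \<open>Z\<close>, so it suffices to let \<open>Z\<close> range over constant fields.\<close>

definition levi_civita ::
  "('e::euclidean_space \<Rightarrow> 'e \<Rightarrow> 'e \<Rightarrow> real) \<Rightarrow> ('e \<Rightarrow> 'e) \<Rightarrow> ('e \<Rightarrow> 'e) \<Rightarrow> 'e \<Rightarrow> 'e" where
  "levi_civita G X Y x = (THE z. \<forall>w. 2 * G x z w = koszul G X Y (\<lambda>_. w) x)"

text \<open>\<open>R(X,Y)Z = \<nabla>\<^sub>X \<nabla>\<^sub>Y Z - \<nabla>\<^sub>Y \<nabla>\<^sub>X Z - \<nabla>\<^bsub>[X,Y]\<^esub> Z\<close>\<close>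

definition riemann ::
  "('e::euclidean_space \<Rightarrow> 'e \<Rightarrow> 'e \<Rightarrow> real) \<Rightarrow> ('e \<Rightarrow> 'e) \<Rightarrow> ('e \<Rightarrow> 'e) \<Rightarrow> ('e \<Rightarrow> 'e) \<Rightarrow> 'e \<Rightarrow> 'e" where
  "riemann G X Y Z x =
     levi_civita G X (levi_civita G Y Z) x
   - levi_civita G Y (levi_civita G X Z) x
   - levi_civita G (lie_bracket X Y) Z x"

text \<open>\<open>Ric(v,w)\<close> is the trace of \<open>u \<mapsto> R(u,v)w\<close>; the sum below is that trace, computed in the
  standard basis of \<^typ>\<open>'e\<close> (which need not be orthonormal for \<^term>\<open>G\<close>).\<close>

definition ricci :: "('e::euclidean_space \<Rightarrow> 'e \<Rightarrow> 'e \<Rightarrow> real) \<Rightarrow> 'e \<Rightarrow> 'e \<Rightarrow> 'e \<Rightarrow> real" where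
  "ricci G x v w = (\<Sum>b\<in>Basis. riemann G (\<lambda>_. b) (\<lambda>_. v) (\<lambda>_. w) x \<bullet> b)"

definition ricci_op :: "('e::euclidean_space \<Rightarrow> 'e \<Rightarrow> 'e \<Rightarrow> real) \<Rightarrow> 'e \<Rightarrow> 'e \<Rightarrow> 'e" where
  "ricci_op G x v = (THE z. \<forall>w. G x z w = ricci G x v w)"


section \<open>Exterior powers\<close>

text \<open>A \<open>k\<close>-form on a vector space is a function of the first \<open>k\<close> entries of a sequence of vectors.\<close>

definition wedge :: "nat \<Rightarrow> nat \<Rightarrow> ((nat \<Rightarrow> 'e) \<Rightarrow> real) \<Rightarrow> ((nat \<Rightarrow> 'e) \<Rightarrow> real) \<Rightarrow> (nat \<Rightarrow> 'e) \<Rightarrow> real" where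
  "wedge k l \<alpha> \<beta> v =
     (\<Sum>\<sigma> | \<sigma> permutes {..<k + l}.
        of_int (sign \<sigma>) * \<alpha> (\<lambda>i. v (\<sigma> i)) * \<beta> (\<lambda>i. v (\<sigma> (k + i)))) / (fact k * fact l)"

primrec wedge_power2 :: "((nat \<Rightarrow> 'e) \<Rightarrow> real) \<Rightarrow> nat \<Rightarrow> (nat \<Rightarrow> 'e) \<Rightarrow> real" where
  "wedge_power2 \<beta> 0 = (\<lambda>_. 1)"
| "wedge_power2 \<beta> (Suc n) = wedge 2 (2 * n) \<beta> (wedge_power2 \<beta> n)"


section \<open>Smooth manifolds\<close>

type_synonym ('a, 'e) chart = "'a set \<times> ('a \<Rightarrow> 'e)"

definition chart_dom :: "('a, 'e) chart \<Rightarrow> 'a set" where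
  "chart_dom \<kappa> = fst \<kappa>"

definition chart_map :: "('a, 'e) chart \<Rightarrow> 'a \<Rightarrow> 'e" where
  "chart_map \<kappa> = snd \<kappa>"

definition chart_img :: "('a, 'e) chart \<Rightarrow> 'e set" where
  "chart_img \<kappa> = chart_map \<kappa> ` chart_dom \<kappa>"

definition chart_inv :: "('a, 'e) chart \<Rightarrow> 'e \<Rightarrow> 'a" where
  "chart_inv \<kappa> = inv_into (chart_dom \<kappa>) (chart_map \<kappa>)"

definition charts_at :: "('a, 'e) chart set \<Rightarrow> 'a \<Rightarrow> ('a, 'e) chart set" where
  "charts_at A p = {\<kappa> \<in> A. p \<in> chart_dom \<kappa>}"

text \<open>Connected smooth manifolds of dimension \<open>DIM('e)\<close>. The smooth structure is given by some
  atlas, not necessarily a maximal one.\<close>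

definition smooth_manifold :: "'a topology \<Rightarrow> ('a, 'e::euclidean_space) chart set \<Rightarrow> bool" where
  "smooth_manifold T A \<longleftrightarrow>
     Hausdorff_space T \<and> second_countable T \<and> connected_space T \<and>
     (\<Union>\<kappa>\<in>A. chart_dom \<kappa>) = topspace T \<and>
     (\<forall>\<kappa>\<in>A. openin T (chart_dom \<kappa>) \<and> open (chart_img \<kappa>) \<and>
        homeomorphic_map (subtopology T (chart_dom \<kappa>)) (top_of_set (chart_img \<kappa>)) (chart_map \<kappa>)) \<and>
     (\<forall>\<kappa>\<in>A. \<forall>\<kappa>'\<in>A.
        smooth_on (chart_map \<kappa> ` (chart_dom \<kappa> \<inter> chart_dom \<kappa>')) (chart_map \<kappa>' \<circ> chart_inv \<kappa>))"

definition smooth_function :: "('a, 'e::euclidean_space) chart set \<Rightarrow> ('a \<Rightarrow> real) \<Rightarrow> bool" where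
  "smooth_function A f \<longleftrightarrow> (\<forall>\<kappa>\<in>A. smooth_on (chart_img \<kappa>) (f \<circ> chart_inv \<kappa>))"


section \<open>Tangent vectors and tensor fields\<close>

text \<open>A tangent vector at \<open>p\<close> is the family of its components in the charts around \<open>p\<close>, related by the
  derivatives of the transition maps (and \<open>0\<close> at the charts not containing \<open>p\<close>).\<close>

type_synonym ('a, 'e) tangent = "('a, 'e) chart \<Rightarrow> 'e"

definition transition_deriv ::
  "('a, 'e::euclidean_space) chart \<Rightarrow> ('a, 'e) chart \<Rightarrow> 'a \<Rightarrow> 'e \<Rightarrow> 'e" where
  "transition_deriv \<kappa> \<kappa>' p = frechet_derivative (chart_map \<kappa>' \<circ> chart_inv \<kappa>) (at (chart_map \<kappa> p))"

definition tangent_space ::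
  "('a, 'e::euclidean_space) chart set \<Rightarrow> 'a \<Rightarrow> ('a, 'e) tangent set" where
  "tangent_space A p =
     {v. (\<forall>\<kappa>\<in>charts_at A p. \<forall>\<kappa>'\<in>charts_at A p. v \<kappa>' = transition_deriv \<kappa> \<kappa>' p (v \<kappa>)) \<and>
         (\<forall>\<kappa>. \<kappa> \<notin> charts_at A p \<longrightarrow> v \<kappa> = 0)}"

definition tlincomb ::
  "real \<Rightarrow> ('a, 'e::euclidean_space) tangent \<Rightarrow> real \<Rightarrow> ('a, 'e) tangent \<Rightarrow> ('a, 'e) tangent" where
  "tlincomb a u b v = (\<lambda>\<kappa>. a *\<^sub>R u \<kappa> + b *\<^sub>R v \<kappa>)"

text \<open>The tangent vector at \<open>p\<close> whose component in the chart \<open>\<kappa>\<close> around \<open>p\<close> is \<open>w\<close>.\<close>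

definition chart_vec ::
  "('a, 'e::euclidean_space) chart set \<Rightarrow> ('a, 'e) chart \<Rightarrow> 'a \<Rightarrow> 'e \<Rightarrow> ('a, 'e) tangent" where
  "chart_vec A \<kappa> p w = (\<lambda>\<kappa>'. if \<kappa>' \<in> charts_at A p then transition_deriv \<kappa> \<kappa>' p w else 0)"

text \<open>Representations in a chart of vector fields, 1-forms, endomorphism fields and metrics.\<close>

definition rep_vec :: "('a, 'e::euclidean_space) chart \<Rightarrow> ('a \<Rightarrow> ('a, 'e) tangent) \<Rightarrow> 'e \<Rightarrow> 'e" where
  "rep_vec \<kappa> X x = X (chart_inv \<kappa> x) \<kappa>"

definition rep_form ::
  "('a, 'e::euclidean_space) chart set \<Rightarrow> ('a, 'e) chart \<Rightarrow> ('a \<Rightarrow> ('a, 'e) tangent \<Rightarrow> real) \<Rightarrow>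
   'e \<Rightarrow> 'e \<Rightarrow> real" where
  "rep_form A \<kappa> \<alpha> x w = \<alpha> (chart_inv \<kappa> x) (chart_vec A \<kappa> (chart_inv \<kappa> x) w)"

definition rep_endo ::
  "('a, 'e::euclidean_space) chart set \<Rightarrow> ('a, 'e) chart \<Rightarrow>
   ('a \<Rightarrow> ('a, 'e) tangent \<Rightarrow> ('a, 'e) tangent) \<Rightarrow> 'e \<Rightarrow> 'e \<Rightarrow> 'e" where
  "rep_endo A \<kappa> \<phi> x w = \<phi> (chart_inv \<kappa> x) (chart_vec A \<kappa> (chart_inv \<kappa> x) w) \<kappa>"

definition rep_metric ::
  "('a, 'e::euclidean_space) chart set \<Rightarrow> ('a, 'e) chart \<Rightarrow>
   ('a \<Rightarrow> ('a, 'e) tangent \<Rightarrow> ('a, 'e) tangent \<Rightarrow> real) \<Rightarrow> 'e \<Rightarrow> 'e \<Rightarrow> 'e \<Rightarrow> real" where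
  "rep_metric A \<kappa> g x u w =
     g (chart_inv \<kappa> x) (chart_vec A \<kappa> (chart_inv \<kappa> x) u) (chart_vec A \<kappa> (chart_inv \<kappa> x) w)"

definition vector_field ::
  "'a topology \<Rightarrow> ('a, 'e::euclidean_space) chart set \<Rightarrow> ('a \<Rightarrow> ('a, 'e) tangent) \<Rightarrow> bool" where
  "vector_field T A X \<longleftrightarrow>
     (\<forall>p\<in>topspace T. X p \<in> tangent_space A p) \<and>
     (\<forall>\<kappa>\<in>A. smooth_on (chart_img \<kappa>) (rep_vec \<kappa> X))"

definition one_form ::
  "'a topology \<Rightarrow> ('a, 'e::euclidean_space) chart set \<Rightarrow>
   ('a \<Rightarrow> ('a, 'e) tangent \<Rightarrow> real) \<Rightarrow> bool" where
  "one_form T A \<alpha> \<longleftrightarrow>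
     (\<forall>p\<in>topspace T. \<forall>u\<in>tangent_space A p. \<forall>v\<in>tangent_space A p. \<forall>a b.
        \<alpha> p (tlincomb a u b v) = a * \<alpha> p u + b * \<alpha> p v) \<and>
     (\<forall>\<kappa>\<in>A. \<forall>w. smooth_on (chart_img \<kappa>) (\<lambda>x. rep_form A \<kappa> \<alpha> x w))"

definition endo_field ::
  "'a topology \<Rightarrow> ('a, 'e::euclidean_space) chart set \<Rightarrow>
   ('a \<Rightarrow> ('a, 'e) tangent \<Rightarrow> ('a, 'e) tangent) \<Rightarrow> bool" where
  "endo_field T A \<phi> \<longleftrightarrow>
     (\<forall>p\<in>topspace T. \<forall>u\<in>tangent_space A p. \<phi> p u \<in> tangent_space A p) \<and>
     (\<forall>p\<in>topspace T. \<forall>u\<in>tangent_space A p. \<forall>v\<in>tangent_space A p. \<forall>a b.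
        \<phi> p (tlincomb a u b v) = tlincomb a (\<phi> p u) b (\<phi> p v)) \<and>
     (\<forall>\<kappa>\<in>A. \<forall>w. smooth_on (chart_img \<kappa>) (\<lambda>x. rep_endo A \<kappa> \<phi> x w))"

definition riemannian_metric ::
  "'a topology \<Rightarrow> ('a, 'e::euclidean_space) chart set \<Rightarrow>
   ('a \<Rightarrow> ('a, 'e) tangent \<Rightarrow> ('a, 'e) tangent \<Rightarrow> real) \<Rightarrow> bool" where
  "riemannian_metric T A g \<longleftrightarrow>
     (\<forall>p\<in>topspace T. \<forall>u\<in>tangent_space A p. \<forall>v\<in>tangent_space A p. \<forall>w\<in>tangent_space A p. \<forall>a b.
        g p (tlincomb a u b v) w = a * g p u w + b * g p v w) \<and>
     (\<forall>p\<in>topspace T. \<forall>u\<in>tangent_space A p. \<forall>v\<in>tangent_space A p. g p u v = g p v u) \<and>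
     (\<forall>p\<in>topspace T. \<forall>u\<in>tangent_space A p. u \<noteq> (\<lambda>_. 0) \<longrightarrow> g p u u > 0) \<and>
     (\<forall>\<kappa>\<in>A. \<forall>u w. smooth_on (chart_img \<kappa>) (\<lambda>x. rep_metric A \<kappa> g x u w))"

definition killing_field ::
  "'a topology \<Rightarrow> ('a, 'e::euclidean_space) chart set \<Rightarrow>
   ('a \<Rightarrow> ('a, 'e) tangent \<Rightarrow> ('a, 'e) tangent \<Rightarrow> real) \<Rightarrow> ('a \<Rightarrow> ('a, 'e) tangent) \<Rightarrow> bool" where
  "killing_field T A g V \<longleftrightarrow>
     vector_field T A V \<and>
     (\<forall>\<kappa>\<in>A. \<forall>X Y. smooth_on (chart_img \<kappa>) X \<longrightarrow> smooth_on (chart_img \<kappa>) Y \<longrightarrow>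
        (\<forall>x\<in>chart_img \<kappa>. lie_deriv_metric (rep_vec \<kappa> V) (rep_metric A \<kappa> g) X Y x = 0))"

definition ricci_operator ::
  "('a, 'e::euclidean_space) chart set \<Rightarrow>
   ('a \<Rightarrow> ('a, 'e) tangent \<Rightarrow> ('a, 'e) tangent \<Rightarrow> real) \<Rightarrow>
   'a \<Rightarrow> ('a, 'e) tangent \<Rightarrow> ('a, 'e) tangent" where
  "ricci_operator A g p v =
     (\<lambda>\<kappa>. if \<kappa> \<in> charts_at A p then ricci_op (rep_metric A \<kappa> g) (chart_map \<kappa> p) (v \<kappa>) else 0)"


section \<open>Contact metric structures\<close>

text \<open>\<open>\<eta> \<and> (d\<eta>)\<^sup>n\<close> is a volume form, i.e. a nowhere vanishing form of top degree. At a point, \<open>d\<eta>\<close> is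
  evaluated by extending vectors to coordinate fields.\<close>

definition contact_form ::
  "'a topology \<Rightarrow> ('a, 'e::euclidean_space) chart set \<Rightarrow>
   ('a \<Rightarrow> ('a, 'e) tangent \<Rightarrow> real) \<Rightarrow> bool" where
  "contact_form T A \<eta> \<longleftrightarrow>
     one_form T A \<eta> \<and>
     (\<exists>n\<ge>1. DIM('e) = 2 * n + 1 \<and>
        (\<forall>\<kappa>\<in>A. \<forall>x\<in>chart_img \<kappa>. \<exists>v.
           wedge 1 (2 * n) (\<lambda>v. rep_form A \<kappa> \<eta> x (v 0))
             (wedge_power2 (\<lambda>v. ext_deriv (rep_form A \<kappa> \<eta>) (\<lambda>_. v 0) (\<lambda>_. v 1) x) n) v \<noteq> 0))"

definition reeb_field ::
  "'a topology \<Rightarrow> ('a, 'e::euclidean_space) chart set \<Rightarrow>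
   ('a \<Rightarrow> ('a, 'e) tangent \<Rightarrow> real) \<Rightarrow> ('a \<Rightarrow> ('a, 'e) tangent) \<Rightarrow> bool" where
  "reeb_field T A \<eta> \<xi> \<longleftrightarrow>
     vector_field T A \<xi> \<and>
     (\<forall>p\<in>topspace T. \<eta> p (\<xi> p) = 1) \<and>
     (\<forall>\<kappa>\<in>A. \<forall>X. smooth_on (chart_img \<kappa>) X \<longrightarrow>
        (\<forall>x\<in>chart_img \<kappa>. ext_deriv (rep_form A \<kappa> \<eta>) (rep_vec \<kappa> \<xi>) X x = 0))"

definition contact_metric_structure ::
  "'a topology \<Rightarrow> ('a, 'e::euclidean_space) chart set \<Rightarrow>
   ('a \<Rightarrow> ('a, 'e) tangent \<Rightarrow> real) \<Rightarrow> ('a \<Rightarrow> ('a, 'e) tangent) \<Rightarrow>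
   ('a \<Rightarrow> ('a, 'e) tangent \<Rightarrow> ('a, 'e) tangent) \<Rightarrow>
   ('a \<Rightarrow> ('a, 'e) tangent \<Rightarrow> ('a, 'e) tangent \<Rightarrow> real) \<Rightarrow> bool" where
  "contact_metric_structure T A \<eta> \<xi> \<phi> g \<longleftrightarrow>
     smooth_manifold T A \<and> contact_form T A \<eta> \<and> reeb_field T A \<eta> \<xi> \<and>
     endo_field T A \<phi> \<and> riemannian_metric T A g \<and>
     (\<forall>p\<in>topspace T. g p (\<xi> p) (\<xi> p) = 1) \<and>
     (\<forall>p\<in>topspace T. \<forall>v\<in>tangent_space A p. \<phi> p (\<phi> p v) = tlincomb (- 1) v (\<eta> p v) (\<xi> p)) \<and>
     (\<forall>p\<in>topspace T. \<phi> p (\<xi> p) = (\<lambda>_. 0)) \<and>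
     (\<forall>\<kappa>\<in>A. \<forall>X Y. smooth_on (chart_img \<kappa>) X \<longrightarrow> smooth_on (chart_img \<kappa>) Y \<longrightarrow>
        (\<forall>x\<in>chart_img \<kappa>. ext_deriv (rep_form A \<kappa> \<eta>) X Y x =
           2 * rep_metric A \<kappa> g x (X x) (rep_endo A \<kappa> \<phi> x (Y x))))"

definition K_contact ::
  "'a topology \<Rightarrow> ('a, 'e::euclidean_space) chart set \<Rightarrow>
   ('a \<Rightarrow> ('a, 'e) tangent \<Rightarrow> real) \<Rightarrow> ('a \<Rightarrow> ('a, 'e) tangent) \<Rightarrow>
   ('a \<Rightarrow> ('a, 'e) tangent \<Rightarrow> ('a, 'e) tangent) \<Rightarrow>
   ('a \<Rightarrow> ('a, 'e) tangent \<Rightarrow> ('a, 'e) tangent \<Rightarrow> real) \<Rightarrow> bool" where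
  "K_contact T A \<eta> \<xi> \<phi> g \<longleftrightarrow>
     contact_metric_structure T A \<eta> \<xi> \<phi> g \<and> killing_field T A g \<xi>"

definition strict_generalized_eta_einstein ::
  "'a topology \<Rightarrow> ('a, 'e::euclidean_space) chart set \<Rightarrow>
   ('a \<Rightarrow> ('a, 'e) tangent \<Rightarrow> real) \<Rightarrow> ('a \<Rightarrow> ('a, 'e) tangent) \<Rightarrow>
   ('a \<Rightarrow> ('a, 'e) tangent \<Rightarrow> ('a, 'e) tangent \<Rightarrow> real) \<Rightarrow> bool" where
  "strict_generalized_eta_einstein T A \<eta> \<xi> g \<longleftrightarrow>
     (\<exists>lam \<gamma>. smooth_function A lam \<and> smooth_function A \<gamma> \<and>
        \<not> (lam constant_on topspace T \<and> \<gamma> constant_on topspace T) \<and>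
        (\<forall>p\<in>topspace T. \<forall>v\<in>tangent_space A p.
           ricci_operator A g p v = tlincomb (lam p) v (\<gamma> p * \<eta> p v) (\<xi> p)))"

end

theory Submission
  imports Defs
begin

text \<open>
  The proof is a local computation in an orthonormal frame \<open>e\<^sub>0 = \<xi>, e\<^sub>1, e\<^sub>2 = \<phi> e\<^sub>1\<close>, followed by
  a connectedness argument.

  In such a frame the symmetric part of \<open>\<nabla>\<xi>\<close> is trace-free, with entries \<open>p, q, q, - p\<close> on the
  plane spanned by \<open>e\<^sub>1\<close> and \<open>e\<^sub>2\<close>, and its skew part is \<open>- \<phi>\<close>. So \<open>\<xi>\<close> is Killing at a point if and
  only if \<open>z = p + i q\<close> vanishes there. In dimension three the Ricci tensor determines the curvature;
  as it is diagonal in the frame, every mixed component of the curvature vanishes. Written with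
  the coefficients \<open>p, q\<close> and \<open>\<omega>\<^sub>i = g(\<nabla>\<^bsub>e\<^sub>i\<^esub> e\<^sub>1, e\<^sub>2)\<close> (lemma \<open>structure_equations\<close>), this gives

  \<^item> \<open>(\<lambda> + \<gamma>) / 2 = 1 - \<bar>z\<bar>\<^sup>2\<close>,
  \<^item> \<open>e\<^sub>0 z = - 2 i \<omega>\<^sub>0 z\<close> and \<open>(e\<^sub>1 - i e\<^sub>2) z = - 2 i (\<omega>\<^sub>1 - i \<omega>\<^sub>2) z\<close>.

  Two of the three complex directional derivatives of \<open>z\<close> are thus known. The commutator of
  \<open>e\<^sub>0\<close> and \<open>e\<^sub>1 - i e\<^sub>2\<close> contains the conjugate of \<open>z\<close> times \<open>e\<^sub>1 + i e\<^sub>2\<close>, so where \<open>z \<noteq> 0\<close> the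
  equality of mixed derivatives yields the third one: \<open>dz = - 2 i \<omega> z\<close>
  (lemma \<open>eigenvalue_derivatives\<close>). Hence \<open>\<bar>z\<bar>\<close>, and with it \<open>\<lambda> + \<gamma>\<close>, is locally constant where
  \<open>z \<noteq> 0\<close>. The remaining commutator, of \<open>e\<^sub>1\<close> and \<open>e\<^sub>2\<close>, says that \<open>d\<omega>(e\<^sub>1, e\<^sub>2) = 0\<close> there,
  and the formula for the curvature of the plane of \<open>e\<^sub>1, e\<^sub>2\<close> turns this into \<open>\<lambda> = 0\<close>
  (lemmas \<open>lam_zero\<close> and \<open>locally_constant\<close>).

  Now let \<open>\<xi>\<close> fail to be Killing at some point, and let \<open>c \<noteq> 2\<close> be the value of \<open>\<lambda> + \<gamma>\<close> there. The
  set where \<open>\<lambda> + \<gamma> = c\<close> is closed, and open by the local statement, hence it is the whole manifold.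
  Therefore \<open>\<lambda> = 0\<close> and \<open>\<gamma> = c\<close> everywhere, so both functions are constant, contrary to strictness.
\<close>

section \<open>Smooth maps on open sets\<close>

abbreviation D :: "('a::real_normed_vector \<Rightarrow> 'b::real_normed_vector) \<Rightarrow> 'a \<Rightarrow> 'a \<Rightarrow> 'b" where
  "D f x v \<equiv> frechet_derivative f (at x) v"

lemma D_eqI: "(f has_derivative f') (at x) \<Longrightarrow> D f x v = f' v"
  using frechet_derivative_at by metis

lemma Ck_on_subset: "Ck_on k S f \<Longrightarrow> T \<subseteq> S \<Longrightarrow> Ck_on k T f"
  by (induction k arbitrary: f) (auto intro: continuous_on_subset)

lemma Ck_on_cong:
  assumes "open S" "Ck_on k S f" "\<And>x. x \<in> S \<Longrightarrow> f x = g x"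
  shows "Ck_on k S g"
  using assms(2,3)
proof (induction k arbitrary: f g)
  case 0
  then show ?case by (metis Ck_on.simps(1) continuous_on_cong)
next
  case (Suc k)
  have *: "(g has_derivative frechet_derivative f (at x)) (at x)" if "x \<in> S" for x
    by (rule has_derivative_transform_within_open[of f _ _ _ S, OF _ assms(1) that])
       (use Suc.prems that in \<open>simp_all add: frechet_derivative_works\<close>)
  have eq: "D f x v = D g x v" if "x \<in> S" for x v
    using D_eqI[OF *[OF that]] by simp
  have "Ck_on k S (\<lambda>x. D g x v)" for v
    by (rule Suc.IH[of "\<lambda>x. D f x v"]) (use Suc.prems eq in auto)
  with * show ?case by (auto simp: differentiable_def)
qed

lemma Ck_on_SucD: "Ck_on (Suc k) S f \<Longrightarrow> Ck_on k S f"
proof (induction k arbitrary: f)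
  case 0
  then show ?case
    by (auto intro!: continuous_at_imp_continuous_on differentiable_imp_continuous_within)
next
  case (Suc k)
  then show ?case by (metis Ck_on.simps(2))
qed

lemma Ck_on_const: "Ck_on k S (\<lambda>_. c)"
  by (induction k arbitrary: c) auto

lemma Ck_on_add:
  assumes "open S" "Ck_on k S f" "Ck_on k S g"
  shows "Ck_on k S (\<lambda>x. f x + g x)"
  using assms(2,3)
proof (induction k arbitrary: f g)
  case 0
  then show ?case by (auto intro: continuous_intros)
next
  case (Suc k)
  have der: "((\<lambda>x. f x + g x) has_derivative (\<lambda>v. D f x v + D g x v)) (at x)" if "x \<in> S" for x
    using Suc.prems that by (intro has_derivative_add) (auto simp: frechet_derivative_works)
  have eq: "D (\<lambda>x. f x + g x) x v = D f x v + D g x v" if "x \<in> S" for x v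
    using D_eqI[OF der[OF that]] .
  have "(\<lambda>x. f x + g x) differentiable at x" if "x \<in> S" for x
    using der[OF that] differentiableI by blast
  moreover have "Ck_on k S (\<lambda>x. D (\<lambda>x. f x + g x) x v)" for v
    by (rule Ck_on_cong[OF assms(1), of _ "\<lambda>x. D f x v + D g x v"])
       (use Suc eq in auto)
  ultimately show ?case by simp
qed

lemma Ck_on_bilinear:
  assumes "bounded_bilinear B" "open S" "Ck_on k S f" "Ck_on k S g"
  shows "Ck_on k S (\<lambda>x. B (f x) (g x))"
  using assms(3,4)
proof (induction k arbitrary: f g)
  case 0
  then show ?case
    using bounded_bilinear.continuous_on[OF assms(1)] by auto
next
  case (Suc k)
  have der: "((\<lambda>x. B (f x) (g x)) has_derivative (\<lambda>v. B (f x) (D g x v) + B (D f x v) (g x))) (at x)"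
    if "x \<in> S" for x
    using Suc.prems that
    by (intro bounded_bilinear.FDERIV[OF assms(1)]) (auto simp: frechet_derivative_works)
  have eq: "D (\<lambda>x. B (f x) (g x)) x v = B (f x) (D g x v) + B (D f x v) (g x)" if "x \<in> S" for x v
    using D_eqI[OF der[OF that]] .
  have "(\<lambda>x. B (f x) (g x)) differentiable at x" if "x \<in> S" for x
    using der[OF that] differentiableI by blast
  moreover have "Ck_on k S (\<lambda>x. D (\<lambda>x. B (f x) (g x)) x v)" for v
  proof (rule Ck_on_cong[OF assms(2)])
    show "Ck_on k S (\<lambda>x. B (f x) (D g x v) + B (D f x v) (g x))"
      using Suc.prems Suc.prems[THEN Ck_on_SucD]
      by (intro Ck_on_add assms(2) Suc.IH) auto
  qed (simp add: eq)
  ultimately show ?case by simp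
qed

text \<open>The inverse square root satisfies \<open>r' = - r\<^sup>3 f' / 2\<close>, so that its regularity bootstraps.\<close>

lemma Ck_on_inverse_sqrt:
  fixes f :: "'e::euclidean_space \<Rightarrow> real"
  assumes "open S" "Ck_on k S f" "\<And>x. x \<in> S \<Longrightarrow> f x > 0"
  shows "Ck_on k S (\<lambda>x. inverse (sqrt (f x)))"
  using assms(2)
proof (induction k)
  case 0
  then show ?case using assms(3) by (auto intro!: continuous_intros simp: less_imp_neq[symmetric])
next
  case (Suc k)
  let ?r = "\<lambda>x. inverse (sqrt (f x))"
  have der: "(?r has_derivative (\<lambda>v. (- 1/2) * (?r x * (?r x * (?r x * D f x v))))) (at x)" if "x \<in> S" for x
  proof -
    have "(f has_derivative (\<lambda>v. D f x v)) (at x)"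
      using Suc.prems that by (auto simp: frechet_derivative_works)
    with assms(3)[OF that] show ?thesis
      by (auto intro!: derivative_eq_intros simp: field_simps power2_eq_square)
  qed
  have eq: "D ?r x v = (- 1/2) * (?r x * (?r x * (?r x * D f x v)))" if "x \<in> S" for x v
    using D_eqI[OF der[OF that]] .
  have "?r differentiable at x" if "x \<in> S" for x
    using der[OF that] differentiableI by blast
  moreover have "Ck_on k S (\<lambda>x. D ?r x v)" for v
  proof (rule Ck_on_cong[OF assms(1)])
    have "Ck_on k S ?r" using Suc Ck_on_SucD by blast
    then show "Ck_on k S (\<lambda>x. (- 1/2) * (?r x * (?r x * (?r x * D f x v))))"
      using Suc.prems
      by (intro Ck_on_bilinear[OF bounded_bilinear_mult] assms(1) Ck_on_const) auto
  qed (simp add: eq)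
  ultimately show ?case by simp
qed

lemma smooth_on_differentiable: "smooth_on S f \<Longrightarrow> x \<in> S \<Longrightarrow> f differentiable at x"
  unfolding smooth_on_def by (metis Ck_on.simps(2))

lemma smooth_on_has_derivative:
  "smooth_on S f \<Longrightarrow> x \<in> S \<Longrightarrow> (f has_derivative (\<lambda>v. D f x v)) (at x)"
  using smooth_on_differentiable frechet_derivative_works by blast

lemma smooth_on_continuous: "smooth_on S f \<Longrightarrow> continuous_on S f"
  unfolding smooth_on_def by (metis Ck_on.simps(1))

lemma smooth_on_derivative: "smooth_on S f \<Longrightarrow> smooth_on S (\<lambda>x. D f x v)"
  unfolding smooth_on_def by (metis Ck_on.simps(2))

lemma smooth_on_subset: "smooth_on S f \<Longrightarrow> T \<subseteq> S \<Longrightarrow> smooth_on T f"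
  unfolding smooth_on_def using Ck_on_subset by blast

lemma smooth_on_cong:
  "open S \<Longrightarrow> smooth_on S f \<Longrightarrow> (\<And>x. x \<in> S \<Longrightarrow> f x = g x) \<Longrightarrow> smooth_on S g"
  unfolding smooth_on_def using Ck_on_cong by blast

lemma smooth_on_const: "smooth_on S (\<lambda>_. c)"
  unfolding smooth_on_def by (simp add: Ck_on_const)

lemma smooth_on_add: "open S \<Longrightarrow> smooth_on S f \<Longrightarrow> smooth_on S g \<Longrightarrow> smooth_on S (\<lambda>x. f x + g x)"
  unfolding smooth_on_def by (simp add: Ck_on_add)

lemma smooth_on_scaleR:
  "open S \<Longrightarrow> smooth_on S f \<Longrightarrow> smooth_on S g \<Longrightarrow> smooth_on S (\<lambda>x. f x *\<^sub>R g x)"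
  unfolding smooth_on_def by (simp add: Ck_on_bilinear[OF bounded_bilinear_scaleR])

lemma smooth_on_mult:
  fixes f g :: "'e::euclidean_space \<Rightarrow> real"
  shows "open S \<Longrightarrow> smooth_on S f \<Longrightarrow> smooth_on S g \<Longrightarrow> smooth_on S (\<lambda>x. f x * g x)"
  unfolding smooth_on_def by (simp add: Ck_on_bilinear[OF bounded_bilinear_mult])

lemma smooth_on_inner:
  "open S \<Longrightarrow> smooth_on S f \<Longrightarrow> smooth_on S g \<Longrightarrow> smooth_on S (\<lambda>x. f x \<bullet> g x)"
  unfolding smooth_on_def by (simp add: Ck_on_bilinear[OF bounded_bilinear_inner])

lemma smooth_on_diff:
  assumes "open S" "smooth_on S f" "smooth_on S g" shows "smooth_on S (\<lambda>x. f x - g x)"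
  using smooth_on_add[OF assms(1,2) smooth_on_scaleR[OF assms(1) smooth_on_const[of _ "-1"] assms(3)]]
  by simp

lemma smooth_on_sum:
  "open S \<Longrightarrow> (\<And>i. i \<in> I \<Longrightarrow> smooth_on S (f i)) \<Longrightarrow> smooth_on S (\<lambda>x. \<Sum>i\<in>I. f i x)"
  by (induction I rule: infinite_finite_induct) (auto intro: smooth_on_const smooth_on_add)

lemma smooth_on_inverse_sqrt:
  fixes f :: "'e::euclidean_space \<Rightarrow> real"
  shows "open S \<Longrightarrow> smooth_on S f \<Longrightarrow> (\<And>x. x \<in> S \<Longrightarrow> f x > 0) \<Longrightarrow>
    smooth_on S (\<lambda>x. inverse (sqrt (f x)))"
  unfolding smooth_on_def by (simp add: Ck_on_inverse_sqrt)

lemma linear_sum_Basis: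
  fixes L :: "'e::euclidean_space \<Rightarrow> 'b::real_vector"
  assumes "linear L"
  shows "L w = (\<Sum>b\<in>Basis. (w \<bullet> b) *\<^sub>R L b)"
  by (metis (no_types, lifting) assms euclidean_representation linear_scale linear_sum sum.cong)

text \<open>Tensor fields are families of linear maps whose values at each constant vector are smooth.
  Expanding in the standard basis transfers smoothness to their values at vector fields.\<close>

lemma smooth_on_apply:
  fixes B :: "'e::euclidean_space \<Rightarrow> 'f::euclidean_space \<Rightarrow> 'b::real_normed_vector"
  assumes "open S" "\<And>x. x \<in> S \<Longrightarrow> linear (B x)" "\<And>w. smooth_on S (\<lambda>x. B x w)" "smooth_on S Y"
  shows "smooth_on S (\<lambda>x. B x (Y x))"
proof (rule smooth_on_cong[OF assms(1)])
  show "smooth_on S (\<lambda>x. \<Sum>b\<in>Basis. (Y x \<bullet> b) *\<^sub>R B x b)"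
    by (intro smooth_on_sum smooth_on_scaleR smooth_on_inner smooth_on_const assms)
qed (use linear_sum_Basis assms(2) in metis)

lemma smooth_on_directional:
  assumes "open S" "smooth_on S f" "smooth_on S X"
  shows "smooth_on S (\<lambda>x. D f x (X x))"
  by (rule smooth_on_apply[where B="\<lambda>x v. D f x v"])
     (auto intro: assms smooth_on_derivative linear_frechet_derivative
        smooth_on_differentiable[OF assms(2)])

lemma D_cong:
  assumes "open S" "x \<in> S" "smooth_on S f" "\<And>y. y \<in> S \<Longrightarrow> f y = g y"
  shows "D f x v = D g x v"
  by (metis assms frechet_derivative_transform_within_open smooth_on_differentiable)

text \<open>Product rules for a tensor field evaluated at vector fields. The first summand differentiates the
  tensor field with its arguments fixed at their values at \<open>x\<close>.\<close>

lemma D_apply: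
  fixes B :: "'e::euclidean_space \<Rightarrow> 'f::euclidean_space \<Rightarrow> 'b::real_normed_vector"
  assumes "open S" "x \<in> S" "\<And>x. x \<in> S \<Longrightarrow> linear (B x)"
    and B: "\<And>w. (\<lambda>x. B x w) differentiable at x" and Y: "Y differentiable at x"
  shows "((\<lambda>x. B x (Y x)) has_derivative (\<lambda>v. D (\<lambda>y. B y (Y x)) x v + B x (D Y x v))) (at x)"
proof (rule has_derivative_transform_within_open[OF _ assms(1,2)])
  let ?c = "Y x"
  have dB: "((\<lambda>x. B x w) has_derivative (\<lambda>v. D (\<lambda>x. B x w) x v)) (at x)" for w
    using B frechet_derivative_works by blast
  have dY: "(Y has_derivative (\<lambda>v. D Y x v)) (at x)"
    using Y frechet_derivative_works by blast
  have "((\<lambda>y. B y ?c) has_derivative (\<lambda>v. \<Sum>b\<in>Basis. (?c \<bullet> b) *\<^sub>R D (\<lambda>y. B y b) x v)) (at x)"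
  proof (rule has_derivative_transform_within_open[OF _ assms(1,2)])
    show "((\<lambda>y. \<Sum>b\<in>Basis. (?c \<bullet> b) *\<^sub>R B y b) has_derivative
        (\<lambda>v. \<Sum>b\<in>Basis. (?c \<bullet> b) *\<^sub>R D (\<lambda>y. B y b) x v)) (at x)"
      by (intro has_derivative_sum has_derivative_scaleR_right dB)
  qed (rule linear_sum_Basis[OF assms(3), symmetric])
  then have c: "D (\<lambda>y. B y ?c) x v = (\<Sum>b\<in>Basis. (?c \<bullet> b) *\<^sub>R D (\<lambda>y. B y b) x v)" for v
    by (rule D_eqI)
  show "((\<lambda>y. \<Sum>b\<in>Basis. (Y y \<bullet> b) *\<^sub>R B y b) has_derivative
     (\<lambda>v. D (\<lambda>y. B y (Y x)) x v + B x (D Y x v))) (at x)"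
    unfolding c linear_sum_Basis[OF assms(3)[OF assms(2)], of "D Y x _"] sum.distrib[symmetric]
    by (intro has_derivative_sum has_derivative_scaleR has_derivative_inner_left dB dY)
qed (rule linear_sum_Basis[OF assms(3), symmetric])

lemma D_apply2:
  fixes B :: "'e::euclidean_space \<Rightarrow> 'f::euclidean_space \<Rightarrow> 'g::euclidean_space \<Rightarrow> 'b::real_normed_vector"
  assumes "open S" "x \<in> S"
    and l1: "\<And>x w. x \<in> S \<Longrightarrow> linear (\<lambda>u. B x u w)" and l2: "\<And>x u. x \<in> S \<Longrightarrow> linear (B x u)"
    and B: "\<And>u w. (\<lambda>x. B x u w) differentiable at x"
    and Y: "Y differentiable at x" and Z: "Z differentiable at x"
  shows "((\<lambda>x. B x (Y x) (Z x)) has_derivative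
     (\<lambda>v. D (\<lambda>y. B y (Y x) (Z x)) x v + B x (D Y x v) (Z x) + B x (Y x) (D Z x v))) (at x)"
proof -
  have 1: "((\<lambda>x. B x u (Z x)) has_derivative (\<lambda>v. D (\<lambda>y. B y u (Z x)) x v + B x u (D Z x v))) (at x)" for u
    by (rule D_apply[OF assms(1,2)]) (use assms in auto)
  have "((\<lambda>x. B x (Y x) (Z x)) has_derivative
     (\<lambda>v. D (\<lambda>y. B y (Y x) (Z y)) x v + B x (D Y x v) (Z x))) (at x)"
    by (rule D_apply[OF assms(1,2), of "\<lambda>x u. B x u (Z x)"])
       (use l1 Y differentiableI[OF 1] in auto)
  with frechet_derivative_at[OF 1[of "Y x"], symmetric] show ?thesis
    by (simp add: algebra_simps)
qed

lemma D_mult: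
  fixes f g :: "'e::euclidean_space \<Rightarrow> real"
  assumes "smooth_on S f" "smooth_on S g" "x \<in> S"
  shows "D (\<lambda>y. f y * g y) x v = D f x v * g x + f x * D g x v"
  by (rule D_eqI, rule has_derivative_eq_rhs, rule has_derivative_mult)
     (auto intro: smooth_on_has_derivative assms)

lemma D_add:
  assumes "smooth_on S f" "smooth_on S g" "x \<in> S"
  shows "D (\<lambda>y. f y + g y) x v = D f x v + D g x v"
  by (rule D_eqI, rule has_derivative_add) (auto intro: smooth_on_has_derivative assms)

lemma D_diff:
  assumes "smooth_on S f" "smooth_on S g" "x \<in> S"
  shows "D (\<lambda>y. f y - g y) x v = D f x v - D g x v"
  by (rule D_eqI, rule has_derivative_diff) (auto intro: smooth_on_has_derivative assms)

section \<open>Symmetry of second derivatives\<close>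

lemma DERIV_line:
  fixes f :: "'e::euclidean_space \<Rightarrow> real"
  assumes "f differentiable at (y + s *\<^sub>R u)"
  shows "DERIV (\<lambda>s. f (y + s *\<^sub>R u)) s :> D f (y + s *\<^sub>R u) u"
proof -
  let ?z = "y + s *\<^sub>R u"
  have f: "(f has_derivative (\<lambda>v. D f ?z v)) (at ?z)"
    using assms frechet_derivative_works by blast
  have "((\<lambda>s. f (y + s *\<^sub>R u)) has_derivative (\<lambda>h. D f ?z (h *\<^sub>R u))) (at s)"
    by (rule has_derivative_compose[of "\<lambda>s. y + s *\<^sub>R u" "\<lambda>h. h *\<^sub>R u", OF _ f])
       (auto intro!: derivative_eq_intros)
  moreover have "D f ?z (h *\<^sub>R u) = D f ?z u * h" for h
    using linear_scale[OF linear_frechet_derivative[OF assms], of h u] by simp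
  ultimately show ?thesis by (simp add: has_field_derivative_def)
qed

text \<open>Two applications of the mean value theorem, first in the direction \<open>u\<close> to the difference in the
  direction \<open>v\<close>, then in the direction \<open>v\<close> to the derivative along \<open>u\<close>.\<close>

lemma second_difference_mean_value:
  fixes f :: "'e::euclidean_space \<Rightarrow> real"
  assumes "t > 0" "smooth_on S f"
    and S: "\<And>a b. 0 \<le> a \<Longrightarrow> a \<le> t \<Longrightarrow> 0 \<le> b \<Longrightarrow> b \<le> t \<Longrightarrow> x + a *\<^sub>R u + b *\<^sub>R v \<in> S"
  shows "\<exists>a b. 0 \<le> a \<and> a \<le> t \<and> 0 \<le> b \<and> b \<le> t \<and>
    f (x + t *\<^sub>R u + t *\<^sub>R v) - f (x + t *\<^sub>R u) - f (x + t *\<^sub>R v) + f x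
      = t * t * D (\<lambda>y. D f y u) (x + a *\<^sub>R u + b *\<^sub>R v) v"
proof -
  note diff = smooth_on_differentiable[OF assms(2)]
  note diff2 = smooth_on_differentiable[OF smooth_on_derivative[OF assms(2)]]
  define \<phi> where "\<phi> s = f ((x + t *\<^sub>R v) + s *\<^sub>R u) - f (x + s *\<^sub>R u)" for s
  have "DERIV \<phi> s :> D f ((x + t *\<^sub>R v) + s *\<^sub>R u) u - D f (x + s *\<^sub>R u) u" if "0 \<le> s" "s \<le> t" for s
    unfolding \<phi>_def using S[of s t] S[of s 0] assms(1) that
    by (intro DERIV_diff DERIV_line diff) (auto simp: algebra_simps)
  from MVT2[OF assms(1) this] obtain a where a: "0 < a" "a < t"
    "\<phi> t - \<phi> 0 = t * (D f ((x + t *\<^sub>R v) + a *\<^sub>R u) u - D f (x + a *\<^sub>R u) u)"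
    by auto
  have "DERIV (\<lambda>r. D f (x + a *\<^sub>R u + r *\<^sub>R v) u) r :> D (\<lambda>y. D f y u) (x + a *\<^sub>R u + r *\<^sub>R v) v"
    if "0 \<le> r" "r \<le> t" for r
    using S[of a r] a that by (intro DERIV_line diff2) auto
  from MVT2[OF assms(1) this] obtain b where b: "0 < b" "b < t"
    "D f (x + a *\<^sub>R u + t *\<^sub>R v) u - D f (x + a *\<^sub>R u + 0 *\<^sub>R v) u
       = t * D (\<lambda>y. D f y u) (x + a *\<^sub>R u + b *\<^sub>R v) v"
    by auto
  have "f (x + t *\<^sub>R u + t *\<^sub>R v) - f (x + t *\<^sub>R u) - f (x + t *\<^sub>R v) + f x = \<phi> t - \<phi> 0"
    by (simp add: \<phi>_def algebra_simps)
  also have "\<dots> = t * (t * D (\<lambda>y. D f y u) (x + a *\<^sub>R u + b *\<^sub>R v) v)"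
    using a(3) b(3) by (simp add: algebra_simps)
  finally show ?thesis
    using a b by (intro exI[of _ a] exI[of _ b]) auto
qed

text \<open>The second difference is symmetric in \<open>u\<close> and \<open>v\<close>, so it is represented by values of both mixed
  derivatives at points arbitrarily close to \<open>x\<close>. By continuity these derivatives agree at \<open>x\<close>.\<close>

lemma second_derivative_symmetric_real:
  fixes f :: "'e::euclidean_space \<Rightarrow> real"
  assumes "open S" "x \<in> S" "smooth_on S f"
  shows "D (\<lambda>y. D f y u) x v = D (\<lambda>y. D f y v) x u"
proof (rule ccontr)
  define P where "P y = D (\<lambda>y. D f y u) y v" for y
  define R where "R y = D (\<lambda>y. D f y v) y u" for y
  assume "\<not> ?thesis"
  then have ne: "\<bar>P x - R x\<bar> > 0" by (simp add: P_def R_def)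
  let ?e = "\<bar>P x - R x\<bar> / 2"
  have "continuous (at x) P" "continuous (at x) R"
    unfolding P_def R_def using assms
    by (metis continuous_on_eq_continuous_at smooth_on_continuous smooth_on_derivative)+
  then obtain d1 d2 where d: "d1 > 0" "d2 > 0"
    "\<And>y. dist y x < d1 \<Longrightarrow> dist (P y) (P x) < ?e" "\<And>y. dist y x < d2 \<Longrightarrow> dist (R y) (R x) < ?e"
    using ne unfolding continuous_at_eps_delta by (metis half_gt_zero)
  obtain d3 where d3: "d3 > 0" "ball x d3 \<subseteq> S"
    using assms open_contains_ball by blast
  define \<delta> where "\<delta> = min d1 (min d2 d3)"
  have \<delta>: "\<delta> > 0" "\<delta> \<le> d1" "\<delta> \<le> d2" "\<delta> \<le> d3"
    using d d3 by (auto simp: \<delta>_def)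
  \<comment> \<open>With this step length the parallelogram spanned by \<open>t u\<close> and \<open>t v\<close> at \<open>x\<close> lies in the ball of
    radius \<open>\<delta>\<close>; the summand 1 covers the case \<open>u = v = 0\<close>.\<close>
  define t where "t = \<delta> / (2 * (norm u + norm v + 1))"
  have nn: "norm u + norm v + 1 > 0"
    by (meson add_nonneg_pos add_nonneg_nonneg norm_ge_zero zero_less_one)
  then have t: "t > 0" "t * (norm u + norm v + 1) = \<delta> / 2"
    using \<delta> by (simp_all add: t_def field_simps)
  have near: "dist (x + a *\<^sub>R u + b *\<^sub>R v) x < \<delta>" if "0 \<le> a" "a \<le> t" "0 \<le> b" "b \<le> t" for a b
  proof -
    have "dist (x + a *\<^sub>R u + b *\<^sub>R v) x \<le> a * norm u + b * norm v"
      using that norm_triangle_ineq[of "a *\<^sub>R u" "b *\<^sub>R v"] by (simp add: dist_norm algebra_simps)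
    also have "\<dots> \<le> t * norm u + t * norm v"
      using that by (intro add_mono mult_right_mono) auto
    also have "\<dots> \<le> \<delta> / 2" using t by (simp add: algebra_simps)
    finally show ?thesis using \<delta> by simp
  qed
  have inS: "x + a *\<^sub>R u + b *\<^sub>R v \<in> S" if "0 \<le> a" "a \<le> t" "0 \<le> b" "b \<le> t" for a b
    using near[OF that] \<delta> d3 by (auto simp: dist_commute)
  obtain a b where ab: "0 \<le> a" "a \<le> t" "0 \<le> b" "b \<le> t"
    "f (x + t *\<^sub>R u + t *\<^sub>R v) - f (x + t *\<^sub>R u) - f (x + t *\<^sub>R v) + f x
      = t * t * P (x + a *\<^sub>R u + b *\<^sub>R v)"
    using second_difference_mean_value[OF t(1) assms(3) inS] unfolding P_def by blast
  have inS': "x + a *\<^sub>R v + b *\<^sub>R u \<in> S" if "0 \<le> a" "a \<le> t" "0 \<le> b" "b \<le> t" for a b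
    using inS[of b a] that by (simp add: algebra_simps)
  obtain a' b' where ab': "0 \<le> a'" "a' \<le> t" "0 \<le> b'" "b' \<le> t"
    "f (x + t *\<^sub>R v + t *\<^sub>R u) - f (x + t *\<^sub>R v) - f (x + t *\<^sub>R u) + f x
      = t * t * R (x + a' *\<^sub>R v + b' *\<^sub>R u)"
    using second_difference_mean_value[OF t(1) assms(3) inS'] unfolding R_def by blast
  have "x + t *\<^sub>R v + t *\<^sub>R u = x + t *\<^sub>R u + t *\<^sub>R v" by (simp add: algebra_simps)
  then have "f (x + t *\<^sub>R v + t *\<^sub>R u) = f (x + t *\<^sub>R u + t *\<^sub>R v)" by (rule arg_cong)
  with ab(5) ab'(5) have "t * t * P (x + a *\<^sub>R u + b *\<^sub>R v) = t * t * R (x + a' *\<^sub>R v + b' *\<^sub>R u)"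
    by linarith
  with t(1) have "P (x + a *\<^sub>R u + b *\<^sub>R v) = R (x + a' *\<^sub>R v + b' *\<^sub>R u)" by simp
  moreover have "dist (P (x + a *\<^sub>R u + b *\<^sub>R v)) (P x) < ?e"
    by (rule d(3)) (use near[OF ab(1-4)] \<delta> in simp)
  moreover have "dist (R (x + a' *\<^sub>R v + b' *\<^sub>R u)) (R x) < ?e"
    by (rule d(4)) (use near[OF ab'(3,4,1,2)] \<delta> in \<open>simp add: algebra_simps\<close>)
  ultimately show False unfolding dist_real_def by (smt (verit) field_sum_of_halves)
qed

lemma D_inner_const:
  "f differentiable at x \<Longrightarrow> D (\<lambda>y. f y \<bullet> b) x v = D f x v \<bullet> b"
  by (rule D_eqI) (auto intro!: derivative_eq_intros simp: frechet_derivative_works)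

lemma second_derivative_symmetric:
  fixes f :: "'e::euclidean_space \<Rightarrow> 'b::euclidean_space"
  assumes "open S" "x \<in> S" "smooth_on S f"
  shows "D (\<lambda>y. D f y u) x v = D (\<lambda>y. D f y v) x u"
proof (rule euclidean_eqI)
  fix b :: 'b
  have 1: "D (\<lambda>y. D f y w) x z \<bullet> b = D (\<lambda>y. D (\<lambda>y. f y \<bullet> b) y w) x z" for w z
  proof -
    have "D (\<lambda>y. D f y w) x z \<bullet> b = D (\<lambda>y. D f y w \<bullet> b) x z"
      using assms smooth_on_derivative smooth_on_differentiable by (metis D_inner_const)
    also have "\<dots> = D (\<lambda>y. D (\<lambda>y. f y \<bullet> b) y w) x z"
      by (rule D_cong[OF assms(1,2)])
         (auto intro!: smooth_on_inner smooth_on_derivative smooth_on_const assms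
           D_inner_const[symmetric] smooth_on_differentiable[OF assms(3)])
    finally show ?thesis .
  qed
  show "D (\<lambda>y. D f y u) x v \<bullet> b = D (\<lambda>y. D f y v) x u \<bullet> b"
    unfolding 1 by (rule second_derivative_symmetric_real[OF assms(1,2)])
      (intro smooth_on_inner smooth_on_const assms)
qed

lemma D_directional:
  fixes f :: "'e::euclidean_space \<Rightarrow> 'b::euclidean_space"
  assumes "open S" "x \<in> S" "smooth_on S f" "X differentiable at x"
  shows "D (\<lambda>y. D f y (X y)) x v = D (\<lambda>y. D f y (X x)) x v + D f x (D X x v)"
  by (rule D_eqI[OF D_apply[where B="\<lambda>y v. D f y v", OF assms(1,2)]])
     (auto intro: assms linear_frechet_derivative smooth_on_differentiable[OF assms(3)]
       smooth_on_differentiable[OF smooth_on_derivative[OF assms(3)]])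

lemma directional_commutator:
  fixes f :: "'e::euclidean_space \<Rightarrow> 'b::euclidean_space"
  assumes "open S" "x \<in> S" "smooth_on S f" "smooth_on S X" "smooth_on S Y"
  shows "D (\<lambda>y. D f y (Y y)) x (X x) - D (\<lambda>y. D f y (X y)) x (Y x) = D f x (lie_bracket X Y x)"
proof -
  have X: "X differentiable at x" and Y: "Y differentiable at x" and f: "f differentiable at x"
    using assms smooth_on_differentiable by blast+
  show ?thesis
    unfolding D_directional[OF assms(1-3) X] D_directional[OF assms(1-3) Y] lie_bracket_def
      linear_diff[OF linear_frechet_derivative[OF f]]
      second_derivative_symmetric[OF assms(1-3), of "Y x" "X x"]
    by simp
qed

section \<open>The Levi-Civita connection in coordinates\<close>

lemma smooth_on_lie_bracket:
  "open S \<Longrightarrow> smooth_on S X \<Longrightarrow> smooth_on S Y \<Longrightarrow> smooth_on S (lie_bracket X Y)"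
  unfolding lie_bracket_def by (intro smooth_on_diff smooth_on_directional)

lemma linear_D_family:
  assumes "open S" "x \<in> S" "\<And>x. x \<in> S \<Longrightarrow> linear (B x)" "\<And>w. (\<lambda>x. B x w) differentiable at x"
  shows "linear (\<lambda>w. D (\<lambda>y. B y w) x v)"
proof (rule linearI)
  have dB: "((\<lambda>x. B x w) has_derivative (\<lambda>v. D (\<lambda>x. B x w) x v)) (at x)" for w
    using assms(4) frechet_derivative_works by blast
  show "D (\<lambda>y. B y (a + b)) x v = D (\<lambda>y. B y a) x v + D (\<lambda>y. B y b) x v" for a b
    by (rule D_eqI[OF has_derivative_transform_within_open[OF has_derivative_add[OF dB dB] assms(1,2)]])
       (use linear_add[OF assms(3)] in auto)
  show "D (\<lambda>y. B y (r *\<^sub>R a)) x v = r *\<^sub>R D (\<lambda>y. B y a) x v" for a r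
    by (rule D_eqI[OF has_derivative_transform_within_open[OF has_derivative_scaleR_right[OF dB] assms(1,2)]])
       (use linear_scale[OF assms(3)] in auto)
qed

locale local_metric =
  fixes U :: "'e::euclidean_space set" and G :: "'e \<Rightarrow> 'e \<Rightarrow> 'e \<Rightarrow> real"
  assumes open_U: "open U"
    and G_linear1: "x \<in> U \<Longrightarrow> linear (\<lambda>u. G x u w)"
    and G_sym: "x \<in> U \<Longrightarrow> G x u w = G x w u"
    and G_pos: "x \<in> U \<Longrightarrow> u \<noteq> 0 \<Longrightarrow> G x u u > 0"
    and G_smooth: "smooth_on U (\<lambda>x. G x u w)"
begin

lemma G_linear2: "x \<in> U \<Longrightarrow> linear (G x u)"
  using G_linear1[of x u] G_sym[of x] ext[of "G x u" "\<lambda>w. G x w u"] by metis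

lemmas G_simps = linear_add[OF G_linear1] linear_diff[OF G_linear1] linear_scale[OF G_linear1]
  linear_0[OF G_linear1] linear_neg[OF G_linear1] linear_sum[OF G_linear1]
  linear_add[OF G_linear2] linear_diff[OF G_linear2] linear_scale[OF G_linear2]
  linear_0[OF G_linear2] linear_neg[OF G_linear2] linear_sum[OF G_linear2]

lemma G_diff: "x \<in> U \<Longrightarrow> (\<lambda>x. G x u w) differentiable at x"
  using G_smooth smooth_on_differentiable by blast

lemma G_eqI:
  assumes "x \<in> U" "\<And>w. G x a w = G x b w"
  shows "a = b"
  using G_pos[OF assms(1), of "a - b"] assms(2) by (force simp: G_simps(2)[OF assms(1)])

text \<open>The Riesz representation: \<open>u \<mapsto> G x u\<close> is injective, hence onto the dual space.\<close>

lemma G_represents: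
  assumes "x \<in> U" "linear f"
  shows "\<exists>!z. \<forall>w. G x z w = f w"
proof (rule ex_ex1I)
  define L where "L u = (\<Sum>b\<in>Basis. G x u b *\<^sub>R b)" for u
  have L: "linear L"
    unfolding L_def
    by (rule linearI) (simp_all add: G_simps[OF assms(1)] scaleR_add_left sum.distrib scaleR_sum_right)
  have Lb: "L u \<bullet> b = G x u b" if "b \<in> Basis" for u b
    unfolding L_def using that by (simp add: inner_sum_left_Basis)
  have G_L: "G x u w = L u \<bullet> w" for u w
    using linear_sum_Basis[OF G_linear2[OF assms(1)], of u w]
    by (simp add: euclidean_inner[of "L u" w] Lb mult.commute)
  have "inj L"
    unfolding linear_injective_0[OF L] using G_pos[OF assms(1)] G_L by (metis inner_zero_left less_irrefl)
  then have "surj L" by (rule linear_injective_imp_surjective[OF L]) simp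
  then obtain z where "L z = (\<Sum>b\<in>Basis. f b *\<^sub>R b)" by (metis surjD)
  then have "G x z w = f w" for w
    by (simp add: G_L inner_sum_left linear_sum_Basis[OF assms(2), of w] inner_commute[of w] mult.commute)
  then show "\<exists>z. \<forall>w. G x z w = f w" by blast
qed (use G_eqI assms(1) in metis)

text \<open>The covariant derivative differs from the coordinate derivative by this bilinear term
  (\<open>levi_civita_eq\<close> below), so every property of the connection can be read off from it.\<close>

definition christoffel :: "'e \<Rightarrow> 'e \<Rightarrow> 'e \<Rightarrow> 'e" where
  "christoffel x u w = levi_civita G (\<lambda>_. u) (\<lambda>_. w) x"

lemma G_christoffel:
  assumes "x \<in> U"
  shows "2 * G x (christoffel x u w) v =
    D (\<lambda>y. G y w v) x u + D (\<lambda>y. G y u v) x w - D (\<lambda>y. G y u w) x v"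
proof -
  define f where
    "f v = (D (\<lambda>y. G y w v) x u + D (\<lambda>y. G y u v) x w - D (\<lambda>y. G y u w) x v) / 2" for v
  have k: "koszul G (\<lambda>_. u) (\<lambda>_. w) (\<lambda>_. v) x = 2 * f v" for v
    using assms by (simp add: koszul_def lie_bracket_def G_simps f_def)
  have "linear f"
    unfolding f_def
    by (intro linear_compose_scale_right linear_compose_sub linear_compose_add
        linear_D_family[OF open_U assms] G_linear2 G_diff assms
        linear_frechet_derivative[OF G_diff[OF assms]]
        linear_compose[OF _ bounded_linear.linear[OF bounded_linear_divide], unfolded o_def])
  from theI'[OF G_represents[OF assms this]] have "G x (christoffel x u w) v = f v"
    unfolding christoffel_def levi_civita_def k by simp
  then show ?thesis by (simp add: f_def)
qed

lemma christoffel_sym: "x \<in> U \<Longrightarrow> christoffel x u w = christoffel x w u"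
proof (rule G_eqI)
  fix v assume x: "x \<in> U"
  have "D (\<lambda>y. G y u w) x v = D (\<lambda>y. G y w u) x v"
    by (rule D_cong[OF open_U x G_smooth]) (rule G_sym)
  then show "G x (christoffel x u w) v = G x (christoffel x w u) v"
    using G_christoffel[OF x, of u w v] G_christoffel[OF x, of w u v] by simp
qed

lemma christoffel_linear1:
  assumes "x \<in> U"
  shows "linear (\<lambda>u. christoffel x u w)"
proof -
  have l1: "linear (\<lambda>u. D (\<lambda>y. G y w v) x u)" for v
    by (rule linear_frechet_derivative[OF G_diff[OF assms]])
  have l2: "linear (\<lambda>u. D (\<lambda>y. G y u v) x z)" for v z
    by (rule linear_D_family[OF open_U assms]) (use G_linear1 G_diff assms in auto)
  show ?thesis
  proof (rule linearI; rule G_eqI[OF assms])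
    fix a b v and r :: real
    show "G x (christoffel x (a + b) w) v = G x (christoffel x a w + christoffel x b w) v"
      using G_christoffel[OF assms, of a w v] G_christoffel[OF assms, of b w v]
        G_christoffel[OF assms, of "a + b" w v] linear_add[OF l1[of v], of a b]
        linear_add[OF l2[of v w], of a b] linear_add[OF l2[of w v], of a b]
      by (simp add: G_simps[OF assms])
    have "2 * G x (christoffel x (r *\<^sub>R a) w) v = r * (2 * G x (christoffel x a w) v)"
      unfolding G_christoffel[OF assms] linear_scale[OF l1] linear_scale[OF l2[of v w]]
        linear_scale[OF l2[of w v]] by (simp only: real_scaleR_def distrib_left right_diff_distrib)
    then show "G x (christoffel x (r *\<^sub>R a) w) v = G x (r *\<^sub>R christoffel x a w) v"
      by (simp add: G_simps[OF assms])
  qed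
qed

lemma christoffel_linear2: "x \<in> U \<Longrightarrow> linear (christoffel x u)"
  using christoffel_linear1[of x u] christoffel_sym[of x u]
    ext[of "christoffel x u" "\<lambda>w. christoffel x w u"] by metis

text \<open>In the Koszul formula for arbitrary fields the derivatives of \<open>X\<close> cancel and those of \<open>Y\<close> add up to
  \<open>2 g(DY(X), w)\<close>; what remains is the formula for constant fields.\<close>

lemma levi_civita_eq:
  assumes "x \<in> U" "X differentiable at x" "Y differentiable at x"
  shows "levi_civita G X Y x = D Y x (X x) + christoffel x (X x) (Y x)"
proof -
  let ?z = "D Y x (X x) + christoffel x (X x) (Y x)"
  have G2: "D (\<lambda>y. G y (P y) (Q y)) x v =
     D (\<lambda>y. G y (P x) (Q x)) x v + G x (D P x v) (Q x) + G x (P x) (D Q x v)"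
    if "P differentiable at x" "Q differentiable at x" for P Q v
    by (rule D_eqI[OF D_apply2[OF open_U assms(1)]]) (use that G_linear1 G_linear2 G_diff assms in auto)
  have z: "2 * G x ?z w = koszul G X Y (\<lambda>_. w) x" for w
    unfolding koszul_def lie_bracket_def using G_christoffel[OF assms(1), of "X x" "Y x" w]
      G_sym[OF assms(1), of "X x" "D Y x w"] G_sym[OF assms(1), of "Y x" "D X x w"]
    by (simp add: G2[OF assms(3) differentiable_const] G2[OF assms(2) differentiable_const]
        G2[OF assms(2,3)] G_simps[OF assms(1)])
  show ?thesis
    unfolding levi_civita_def
  proof (rule the_equality)
    fix z' assume "\<forall>w. 2 * G x z' w = koszul G X Y (\<lambda>_. w) x"
    with z show "z' = ?z" by (intro G_eqI[OF assms(1)]) (metis mult_cancel_left zero_neq_numeral)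
  qed (use z in blast)
qed

lemma torsion_free:
  assumes "x \<in> U" "X differentiable at x" "Y differentiable at x"
  shows "levi_civita G X Y x - levi_civita G Y X x = lie_bracket X Y x"
  using assms by (simp add: levi_civita_eq lie_bracket_def christoffel_sym[of x "X x"])

lemma metric_compatible:
  assumes "x \<in> U" "V differentiable at x" "X differentiable at x" "Y differentiable at x"
  shows "D (\<lambda>y. G y (X y) (Y y)) x (V x) =
    G x (levi_civita G V X x) (Y x) + G x (X x) (levi_civita G V Y x)"
proof -
  have "D (\<lambda>y. G y (X y) (Y y)) x (V x) =
     D (\<lambda>y. G y (X x) (Y x)) x (V x) + G x (D X x (V x)) (Y x) + G x (X x) (D Y x (V x))"
    by (rule D_eqI[OF D_apply2[OF open_U assms(1)]]) (use G_linear1 G_linear2 G_diff assms in auto)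
  moreover have "D (\<lambda>y. G y (Y x) (X x)) x (V x) = D (\<lambda>y. G y (X x) (Y x)) x (V x)"
    by (rule D_cong[OF open_U assms(1) G_smooth]) (rule G_sym)
  ultimately show ?thesis
    using G_christoffel[OF assms(1), of "V x" "X x" "Y x"] G_christoffel[OF assms(1), of "V x" "Y x" "X x"]
      G_sym[OF assms(1), of "X x" "christoffel x (V x) (Y x)"]
    by (simp add: levi_civita_eq assms G_simps)
qed

text \<open>By metric compatibility and absence of torsion, \<open>V\<close> is Killing exactly when \<open>\<nabla>V\<close> is skew.\<close>

lemma lie_deriv_metric_eq:
  assumes "x \<in> U" "V differentiable at x" "X differentiable at x" "Y differentiable at x"
  shows "lie_deriv_metric V G X Y x =
    G x (levi_civita G X V x) (Y x) + G x (X x) (levi_civita G Y V x)"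
  using assms unfolding lie_deriv_metric_def metric_compatible[OF assms]
  by (simp add: torsion_free[symmetric] G_simps)

end

section \<open>Curvature in an orthonormal frame\<close>

context local_metric
begin

definition curvature :: "'e \<Rightarrow> 'e \<Rightarrow> 'e \<Rightarrow> 'e \<Rightarrow> 'e" where
  "curvature x u v w = riemann G (\<lambda>_. u) (\<lambda>_. v) (\<lambda>_. w) x"

lemma ricci_curvature: "ricci G x v w = (\<Sum>b\<in>Basis. curvature x b v w \<bullet> b)"
  by (simp add: ricci_def curvature_def)

end

locale metric_frame = local_metric U G
  for U :: "'e::euclidean_space set" and G :: "'e \<Rightarrow> 'e \<Rightarrow> 'e \<Rightarrow> real" +
  fixes E :: "nat \<Rightarrow> 'e \<Rightarrow> 'e"
  assumes E_smooth: "i < DIM('e) \<Longrightarrow> smooth_on U (E i)"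
    and E_orthonormal: "x \<in> U \<Longrightarrow> i < DIM('e) \<Longrightarrow> j < DIM('e) \<Longrightarrow>
      G x (E i x) (E j x) = (if i = j then 1 else 0)"
begin

lemma E_diff: "i < DIM('e) \<Longrightarrow> x \<in> U \<Longrightarrow> E i differentiable at x"
  using E_smooth smooth_on_differentiable by blast

lemma frame_expansion:
  assumes x: "x \<in> U"
  shows "(\<Sum>i<DIM('e). G x u (E i x) *\<^sub>R E i x) = u"
proof -
  let ?e = "\<lambda>i. E i x"
  have G_sum: "G x (\<Sum>i<DIM('e). a i *\<^sub>R ?e i) (?e j) = a j" if "j < DIM('e)" for a j
  proof -
    have "G x (\<Sum>i<DIM('e). a i *\<^sub>R ?e i) (?e j) = (\<Sum>i<DIM('e). a i * G x (?e i) (?e j))"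
      by (simp add: G_simps[OF x])
    also have "\<dots> = (\<Sum>i<DIM('e). if i = j then a j else 0)"
      by (rule sum.cong) (use that in \<open>auto simp: E_orthonormal[OF x]\<close>)
    finally show ?thesis using that by simp
  qed
  have inj: "inj_on ?e {..<DIM('e)}"
    using E_orthonormal[OF x] by (intro inj_onI) (metis lessThan_iff zero_neq_one)
  have "independent (?e ` {..<DIM('e)})"
    unfolding independent_explicit
  proof (intro conjI allI impI ballI)
    fix c v assume c: "(\<Sum>v\<in>?e ` {..<DIM('e)}. c v *\<^sub>R v) = 0" and "v \<in> ?e ` {..<DIM('e)}"
    then obtain j where j: "j < DIM('e)" "v = ?e j" by auto
    from c have "(\<Sum>i<DIM('e). c (?e i) *\<^sub>R ?e i) = 0" by (simp add: sum.reindex[OF inj])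
    with G_sum[OF j(1), of "\<lambda>i. c (?e i)"] j show "c v = 0" by (simp add: G_simps[OF x])
  qed simp
  then have "span (?e ` {..<DIM('e)}) = UNIV"
    using card_eq_dim[of "?e ` {..<DIM('e)}" UNIV] card_image[OF inj] by (auto simp: dim_UNIV)
  then have "u \<in> span (?e ` {..<DIM('e)})" by simp
  then obtain c where "u = (\<Sum>v\<in>?e ` {..<DIM('e)}. c v *\<^sub>R v)"
    unfolding span_finite[OF finite_imageI[OF finite_lessThan]] by (rule rangeE)
  then have u: "u = (\<Sum>i<DIM('e). c (?e i) *\<^sub>R ?e i)" by (simp add: sum.reindex[OF inj])
  with G_sum[of _ "\<lambda>i. c (?e i)"] have "G x u (?e j) = c (?e j)" if "j < DIM('e)" for j
    using that by metis
  then show ?thesis using u by simp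
qed

lemma parseval:
  assumes x: "x \<in> U"
  shows "G x u w = (\<Sum>i<DIM('e). G x u (E i x) * G x w (E i x))"
proof -
  have "G x u w = G x (\<Sum>i<DIM('e). G x u (E i x) *\<^sub>R E i x) w"
    by (simp add: frame_expansion[OF x])
  also have "\<dots> = (\<Sum>i<DIM('e). G x u (E i x) * G x w (E i x))"
    by (simp add: G_simps[OF x] G_sym[OF x, of "E _ x" w])
  finally show ?thesis .
qed

lemma smooth_on_G: "smooth_on U X \<Longrightarrow> smooth_on U Y \<Longrightarrow> smooth_on U (\<lambda>x. G x (X x) (Y x))"
  by (rule smooth_on_apply[OF open_U], rule G_linear2, assumption,
      rule smooth_on_apply[OF open_U, of "\<lambda>x u. G x u w" for w])
     (auto intro: G_linear1 G_smooth)

text \<open>The Christoffel symbols are the solution of a linear system. An orthonormal frame solves it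
  without inverting a matrix, so that smoothness is visible.\<close>

lemma christoffel_smooth: "smooth_on U (\<lambda>x. christoffel x u w)"
proof (rule smooth_on_cong[OF open_U])
  have *: "smooth_on U (\<lambda>x. G x (christoffel x u w) v)" for v
  proof (rule smooth_on_cong[OF open_U])
    show "smooth_on U (\<lambda>x. (1/2) * (D (\<lambda>y. G y w v) x u + D (\<lambda>y. G y u v) x w - D (\<lambda>y. G y u w) x v))"
      by (intro smooth_on_mult smooth_on_const smooth_on_add smooth_on_diff smooth_on_derivative
          G_smooth open_U)
  qed (simp add: G_christoffel[symmetric])
  have "smooth_on U (\<lambda>x. G x (christoffel x u w) (E i x))" if "i < DIM('e)" for i
    by (rule smooth_on_apply[OF open_U G_linear2 * E_smooth[OF that]])
  then show "smooth_on U (\<lambda>x. \<Sum>i<DIM('e). G x (christoffel x u w) (E i x) *\<^sub>R E i x)"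
    by (intro smooth_on_sum smooth_on_scaleR open_U E_smooth) auto
qed (rule frame_expansion)

lemma christoffel_diff: "x \<in> U \<Longrightarrow> (\<lambda>x. christoffel x u w) differentiable at x"
  using christoffel_smooth smooth_on_differentiable by blast

lemma christoffel_smooth_apply:
  "smooth_on U X \<Longrightarrow> smooth_on U Y \<Longrightarrow> smooth_on U (\<lambda>x. christoffel x (X x) (Y x))"
  by (rule smooth_on_apply[OF open_U], rule christoffel_linear2, assumption,
      rule smooth_on_apply[OF open_U, of "\<lambda>x u. christoffel x u w" for w])
     (auto intro: christoffel_linear1 christoffel_smooth)

lemma levi_civita_smooth:
  assumes "smooth_on U X" "smooth_on U Y"
  shows "smooth_on U (levi_civita G X Y)"
proof (rule smooth_on_cong[OF open_U])
  show "smooth_on U (\<lambda>x. D Y x (X x) + christoffel x (X x) (Y x))"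
    by (intro smooth_on_add smooth_on_directional christoffel_smooth_apply open_U assms)
qed (simp add: levi_civita_eq assms[THEN smooth_on_differentiable])

text \<open>The terms are arranged for \<open>riemann_expansion\<close>: the second derivatives of \<open>Z\<close> stay in the first
  one, where the commutator identity applies, and the two terms that contain one derivative of \<open>Z\<close>
  together are symmetric in \<open>X\<close> and \<open>Y\<close>.\<close>

lemma levi_civita_levi_civita:
  assumes x: "x \<in> U" and XYZ: "smooth_on U X" "smooth_on U Y" "smooth_on U Z"
  shows "levi_civita G X (levi_civita G Y Z) x =
    D (\<lambda>y. D Z y (Y y)) x (X x) + D (\<lambda>y. christoffel y (Y x) (Z x)) x (X x)
    + christoffel x (D Y x (X x)) (Z x) + christoffel x (Y x) (D Z x (X x))
    + christoffel x (X x) (D Z x (Y x)) + christoffel x (X x) (christoffel x (Y x) (Z x))"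
proof -
  note diff = XYZ[THEN smooth_on_differentiable]
  have "D (levi_civita G Y Z) x (X x) = D (\<lambda>y. D Z y (Y y) + christoffel y (Y y) (Z y)) x (X x)"
    by (rule D_cong[OF open_U x levi_civita_smooth]) (auto simp: levi_civita_eq diff XYZ)
  also have "\<dots> = D (\<lambda>y. D Z y (Y y)) x (X x) + (D (\<lambda>y. christoffel y (Y x) (Z x)) x (X x)
    + christoffel x (D Y x (X x)) (Z x) + christoffel x (Y x) (D Z x (X x)))"
    by (rule D_eqI[OF has_derivative_add], rule smooth_on_has_derivative[OF _ x],
        rule smooth_on_directional[OF open_U XYZ(3,2)], rule D_apply2[OF open_U x])
       (use christoffel_linear1 christoffel_linear2 christoffel_diff x diff in auto)
  finally show ?thesis
    using levi_civita_eq[OF x diff(1)[OF x]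
        smooth_on_differentiable[OF levi_civita_smooth[OF XYZ(2,3)] x]]
      linear_add[OF christoffel_linear2[OF x], of "X x"]
    by (simp add: levi_civita_eq x diff add.assoc)
qed

lemma riemann_expansion:
  assumes x: "x \<in> U" and XYZ: "smooth_on U X" "smooth_on U Y" "smooth_on U Z"
  shows "riemann G X Y Z x =
    D (\<lambda>y. christoffel y (Y x) (Z x)) x (X x) + christoffel x (X x) (christoffel x (Y x) (Z x))
    - D (\<lambda>y. christoffel y (X x) (Z x)) x (Y x) - christoffel x (Y x) (christoffel x (X x) (Z x))"
proof -
  note diff = XYZ[THEN smooth_on_differentiable[OF _ x]]
  have "levi_civita G (lie_bracket X Y) Z x =
     D Z x (lie_bracket X Y x) + christoffel x (lie_bracket X Y x) (Z x)"
    by (rule levi_civita_eq[OF x _ diff(3)])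
       (rule smooth_on_differentiable[OF smooth_on_lie_bracket[OF open_U XYZ(1,2)] x])
  moreover have "christoffel x (lie_bracket X Y x) (Z x)
     = christoffel x (D Y x (X x)) (Z x) - christoffel x (D X x (Y x)) (Z x)"
    unfolding lie_bracket_def by (rule linear_diff[OF christoffel_linear1[OF x]])
  ultimately show ?thesis
    unfolding riemann_def levi_civita_levi_civita[OF x XYZ]
      levi_civita_levi_civita[OF x XYZ(2,1,3)] directional_commutator[OF open_U x XYZ(3,1,2), symmetric]
    by simp
qed

text \<open>No derivative of the fields survives in \<open>riemann_expansion\<close>. The Ricci tensor is defined with constant
  fields; this lemma allows computing it with the fields of a frame instead.\<close>

lemma riemann_tensorial:
  assumes x: "x \<in> U" and XYZ: "smooth_on U X" "smooth_on U Y" "smooth_on U Z"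
  shows "riemann G X Y Z x = curvature x (X x) (Y x) (Z x)"
  unfolding curvature_def riemann_expansion[OF x XYZ]
  by (subst riemann_expansion[OF x]) (auto intro: smooth_on_const)

lemma curvature_expansion:
  assumes x: "x \<in> U"
  shows "curvature x u v w =
    D (\<lambda>y. christoffel y v w) x u + christoffel x u (christoffel x v w)
    - D (\<lambda>y. christoffel y u w) x v - christoffel x v (christoffel x u w)"
  unfolding curvature_def by (subst riemann_expansion[OF x]) (auto intro: smooth_on_const)

lemma curvature_linear:
  assumes x: "x \<in> U"
  shows "linear (\<lambda>u. curvature x u v w)" "linear (\<lambda>v. curvature x u v w)" "linear (curvature x u v)"
proof -
  note l = linear_compose[OF christoffel_linear1[OF x] christoffel_linear2[OF x], unfolded o_def]
    linear_compose[OF christoffel_linear2[OF x] christoffel_linear2[OF x], unfolded o_def]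
    christoffel_linear1[OF x] linear_frechet_derivative[OF christoffel_diff[OF x]]
    linear_D_family[OF open_U x christoffel_linear1 christoffel_diff[OF x]]
    linear_D_family[OF open_U x christoffel_linear2 christoffel_diff[OF x]]
  show "linear (\<lambda>u. curvature x u v w)" "linear (\<lambda>v. curvature x u v w)" "linear (curvature x u v)"
    unfolding curvature_expansion[OF x] by (intro linear_compose_add linear_compose_sub l; assumption)+
qed

text \<open>The trace is independent of the basis: expanding each vector of the standard basis in the frame and
  summing over the standard basis first leaves the trace in the frame.\<close>

lemma ricci_frame:
  assumes x: "x \<in> U"
  shows "ricci G x v w = (\<Sum>k<DIM('e). G x (curvature x (E k x) v w) (E k x))"
proof -
  let ?L = "\<lambda>u. curvature x u v w" and ?e = "\<lambda>i. E i x"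
  note L = curvature_linear(1)[OF x, of v w]
  have dual: "(\<Sum>b\<in>Basis. G x b (?e k) * (a \<bullet> b)) = G x a (?e k)" for a k
    using linear_sum_Basis[OF G_linear1[OF x], of a "?e k"] by (simp add: mult.commute)
  have "ricci G x v w = (\<Sum>b\<in>Basis. ?L (\<Sum>k<DIM('e). G x b (?e k) *\<^sub>R ?e k) \<bullet> b)"
    unfolding ricci_curvature frame_expansion[OF x] ..
  also have "\<dots> = (\<Sum>b\<in>Basis. \<Sum>k<DIM('e). G x b (?e k) * (?L (?e k) \<bullet> b))"
    by (simp add: linear_sum[OF L] linear_scale[OF L] inner_sum_left)
  also have "\<dots> = (\<Sum>k<DIM('e). \<Sum>b\<in>Basis. G x b (?e k) * (?L (?e k) \<bullet> b))"
    by (rule sum.swap)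
  finally show ?thesis by (simp add: dual)
qed

lemma ricci_linear:
  assumes x: "x \<in> U"
  shows "linear (ricci G x v)"
proof -
  have "ricci G x v = (\<lambda>w. \<Sum>k<DIM('e). G x (curvature x (E k x) v w) (E k x))"
    using ricci_frame[OF x] by blast
  then show ?thesis
    using linear_compose[OF curvature_linear(3)[OF x] G_linear1[OF x]]
    by (simp add: o_def linear_compose_sum)
qed

text \<open>The Ricci tensor is linear in its second argument, so its Riesz representative exists and the
  definite description in \<open>ricci_op\<close> denotes it.\<close>

lemma G_ricci_op: "x \<in> U \<Longrightarrow> G x (ricci_op G x v) w = ricci G x v w"
  using theI'[OF G_represents[OF _ ricci_linear]] unfolding ricci_op_def by blast

definition conn :: "nat \<Rightarrow> nat \<Rightarrow> nat \<Rightarrow> 'e \<Rightarrow> real" where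
  "conn i j k x = G x (levi_civita G (E i) (E j) x) (E k x)"

lemma conn_smooth:
  "i < DIM('e) \<Longrightarrow> j < DIM('e) \<Longrightarrow> k < DIM('e) \<Longrightarrow> smooth_on U (conn i j k)"
  unfolding conn_def by (intro smooth_on_G levi_civita_smooth E_smooth)

lemma conn_antisym:
  assumes "x \<in> U" "i < DIM('e)" "j < DIM('e)" "k < DIM('e)"
  shows "conn i j k x = - conn i k j x"
proof -
  have "D (\<lambda>y. G y (E j y) (E k y)) x (E i x) = D (\<lambda>y. if j = k then 1 else 0) x (E i x)"
    by (rule D_cong[OF open_U assms(1) smooth_on_G]) (auto intro: E_smooth assms simp: E_orthonormal assms)
  then show ?thesis
    using metric_compatible[OF assms(1) E_diff E_diff E_diff, of i j k] assms
      G_sym[OF assms(1), of "E j x"]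
    by (simp add: conn_def)
qed

lemma G_lie_bracket_frame:
  assumes "x \<in> U" "i < DIM('e)" "j < DIM('e)"
  shows "G x (lie_bracket (E i) (E j) x) (E m x) = conn i j m x - conn j i m x"
  using assms by (simp add: conn_def torsion_free[OF _ E_diff E_diff, symmetric] G_simps)

lemma lie_bracket_frame:
  assumes "x \<in> U" "i < DIM('e)" "j < DIM('e)"
  shows "lie_bracket (E i) (E j) x = (\<Sum>m<DIM('e). (conn i j m x - conn j i m x) *\<^sub>R E m x)"
  unfolding G_lie_bracket_frame[OF assms, symmetric] frame_expansion[OF assms(1)] ..

lemma levi_civita_frame:
  assumes x: "x \<in> U" and X: "X differentiable at x" and k: "k < DIM('e)"
  shows "levi_civita G X (E k) x = (\<Sum>m<DIM('e). G x (X x) (E m x) *\<^sub>R levi_civita G (E m) (E k) x)"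
proof -
  define L where "L u = D (E k) x u + christoffel x u (E k x)" for u
  have L: "linear L" unfolding L_def
    by (intro linear_compose_add christoffel_linear1 x linear_frechet_derivative E_diff k)
  have "levi_civita G X (E k) x = L (\<Sum>m<DIM('e). G x (X x) (E m x) *\<^sub>R E m x)"
    unfolding frame_expansion[OF x] L_def by (rule levi_civita_eq[OF x X E_diff[OF k x]])
  also have "\<dots> = (\<Sum>m<DIM('e). G x (X x) (E m x) *\<^sub>R levi_civita G (E m) (E k) x)"
    unfolding linear_sum[OF L] linear_scale[OF L]
    by (rule sum.cong) (auto simp: L_def levi_civita_eq[OF x E_diff E_diff] x k)
  finally show ?thesis .
qed

text \<open>Metric compatibility moves the outer covariant derivative in \<open>g(\<nabla>\<^bsub>e\<^sub>i\<^esub> \<nabla>\<^bsub>e\<^sub>j\<^esub> e\<^sub>k, e\<^sub>l)\<close> onto a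
  connection coefficient, at the cost of \<open>g(\<nabla>\<^bsub>e\<^sub>j\<^esub> e\<^sub>k, \<nabla>\<^bsub>e\<^sub>i\<^esub> e\<^sub>l)\<close>, which Parseval's identity expands.\<close>

lemma curvature_frame:
  assumes x: "x \<in> U" and ijkl: "i < DIM('e)" "j < DIM('e)" "k < DIM('e)" "l < DIM('e)"
  shows "G x (curvature x (E i x) (E j x) (E k x)) (E l x) =
    D (conn j k l) x (E i x) - D (conn i k l) x (E j x)
    - (\<Sum>m<DIM('e). conn j k m x * conn i l m x) + (\<Sum>m<DIM('e). conn i k m x * conn j l m x)
    - (\<Sum>m<DIM('e). (conn i j m x - conn j i m x) * conn m k l x)"
proof -
  have second: "G x (levi_civita G (E a) (levi_civita G (E b) (E k)) x) (E l x) =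
      D (conn b k l) x (E a x) - (\<Sum>m<DIM('e). conn b k m x * conn a l m x)"
    if ab: "a < DIM('e)" "b < DIM('e)" for a b
  proof -
    have "levi_civita G (E b) (E k) differentiable at x"
      using levi_civita_smooth E_smooth ab ijkl x smooth_on_differentiable by blast
    from metric_compatible[OF x E_diff[OF ab(1) x] this E_diff[OF ijkl(4) x]]
      parseval[OF x, of "levi_civita G (E b) (E k) x" "levi_civita G (E a) (E l) x"]
    show ?thesis by (simp add: conn_def[abs_def])
  qed
  have br: "levi_civita G (lie_bracket (E i) (E j)) (E k) x =
     (\<Sum>m<DIM('e). (conn i j m x - conn j i m x) *\<^sub>R levi_civita G (E m) (E k) x)"
  proof -
    have "lie_bracket (E i) (E j) differentiable at x"
      using smooth_on_lie_bracket[OF open_U] E_smooth ijkl x smooth_on_differentiable by blast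
    from levi_civita_frame[OF x this ijkl(3)] show ?thesis
      by (simp add: G_lie_bracket_frame[OF x ijkl(1,2)])
  qed
  have "curvature x (E i x) (E j x) (E k x) = riemann G (E i) (E j) (E k) x"
    by (intro riemann_tensorial[symmetric] x E_smooth ijkl)
  then show ?thesis
    unfolding riemann_def br
    by (simp add: G_simps[OF x] second ijkl) (simp add: conn_def)
qed

end

section \<open>Structure equations of a contact frame with diagonal Ricci tensor\<close>

lemma (in metric_frame) curvature_antisym:
  "x \<in> U \<Longrightarrow> curvature x u v w = - curvature x v u w"
  by (simp add: curvature_expansion)

lemma (in metric_frame) curvature_frame_antisym:
  assumes x: "x \<in> U" and ijkl: "i < DIM('e)" "j < DIM('e)" "k < DIM('e)" "l < DIM('e)"
  shows "G x (curvature x (E i x) (E j x) (E k x)) (E l x) =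
    - G x (curvature x (E i x) (E j x) (E l x)) (E k x)"
proof -
  have d: "D (conn a k l) x v = - D (conn a l k) x v" if "a < DIM('e)" for a v
  proof -
    have "D (conn a k l) x v = D (\<lambda>y. 0 - conn a l k y) x v"
      by (rule D_cong[OF open_U x conn_smooth[OF that ijkl(3,4)]])
         (simp add: conn_antisym[OF _ that ijkl(3,4)])
    also have "\<dots> = - D (conn a l k) x v"
      by (rule D_eqI, rule has_derivative_eq_rhs,
          rule has_derivative_diff[OF has_derivative_const smooth_on_has_derivative[OF conn_smooth x]])
         (use that ijkl in auto)
    finally show ?thesis .
  qed
  have "(\<Sum>m<DIM('e). (conn i j m x - conn j i m x) * conn m k l x)
      = - (\<Sum>m<DIM('e). (conn i j m x - conn j i m x) * conn m l k x)"
    unfolding sum_negf[symmetric] by (rule sum.cong) (auto simp: conn_antisym[OF x _ ijkl(3,4)])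
  then show ?thesis
    unfolding curvature_frame[OF x ijkl] curvature_frame[OF x ijkl(1,2,4,3)]
    by (simp add: d ijkl mult.commute)
qed

text \<open>The algebra behind \<open>eigenvalue_derivatives\<close>. A digit \<open>i\<close> after a name stands for the derivative along
  \<open>e\<^sub>i\<close>; in \<open>p01\<close> the function is first differentiated along \<open>e\<^sub>1\<close>, then along \<open>e\<^sub>0\<close>. With
  \<open>z = p + i q\<close> the hypotheses say \<open>e\<^sub>0 z = - 2 i w z\<close> and \<open>(e\<^sub>1 - i e\<^sub>2) z = - 2 (t + i s) z\<close>, together
  with the derivative of the second equation along \<open>e\<^sub>0\<close> and the commutators of \<open>e\<^sub>0\<close> with
  \<open>e\<^sub>1\<close> and \<open>e\<^sub>2\<close>. Eliminating all second derivatives leaves the conjugate of \<open>z\<close> times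
  \<open>(e\<^sub>1 + i e\<^sub>2) z - 2 (t - i s) z\<close> equal to zero.\<close>

lemma eigenvalue_integrability:
  fixes p q w s t :: real
  assumes "p0 = 2 * q * w" "q0 = - 2 * p * w"
    and "q1 - p2 = - 2 * (p * s + q * t)" "p1 + q2 = 2 * (q * s - p * t)"
    and "s0 = w1 - p * s + (w - q + 1) * t" "t0 = w2 - (w + q + 1) * s + p * t"
    and "p01 = 2 * (q1 * w + q * w1) - p * p1 + (w - q + 1) * p2"
    and "p02 = 2 * (q2 * w + q * w2) - (w + q + 1) * p1 + p * p2"
    and "q01 = - 2 * (p1 * w + p * w1) - p * q1 + (w - q + 1) * q2"
    and "q02 = - 2 * (p2 * w + p * w2) - (w + q + 1) * q1 + p * q2"
    and "q01 - p02 = - 2 * (p0 * s + p * s0 + q0 * t + q * t0)"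
    and "p01 + q02 = 2 * (q0 * s + q * s0 - p0 * t - p * t0)"
    and nz: "p\<^sup>2 + q\<^sup>2 \<noteq> 0"
  shows "p1 = 2 * q * s" "p2 = 2 * q * t" "q1 = - 2 * p * s" "q2 = - 2 * p * t"
proof -
  \<comment> \<open>Real and imaginary part of \<open>(e\<^sub>1 + i e\<^sub>2) z - 2 (t - i s) z\<close>.\<close>
  define X where "X = p1 - q2 - 2 * (t * p + s * q)"
  define Y where "Y = q1 + p2 - 2 * (t * q - s * p)"
  have "p * X + q * Y = 0" "p * Y - q * X = 0"
    using assms(1-12) unfolding X_def Y_def by algebra+
  then have "(p\<^sup>2 + q\<^sup>2) * X = 0" "(p\<^sup>2 + q\<^sup>2) * Y = 0" by algebra+
  with nz have "X = 0" "Y = 0" by (metis mult_eq_0_iff)+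
  with assms(3,4) show "p1 = 2 * q * s" "p2 = 2 * q * t" "q1 = - 2 * p * s" "q2 = - 2 * p * t"
    unfolding X_def Y_def by (simp_all add: algebra_simps)
qed

text \<open>The brackets encode \<open>d\<eta>\<close> for \<open>\<eta> = g(e\<^sub>0, _)\<close> and \<open>e\<^sub>2 = \<phi> e\<^sub>1\<close>: the form \<open>\<eta>\<close> is constant on each
  field of the frame, so that \<open>d\<eta>(e\<^sub>i, e\<^sub>j) = - g(e\<^sub>0, [e\<^sub>i, e\<^sub>j])\<close>.\<close>

locale eta_einstein_frame = metric_frame U G E
  for U :: "'e::euclidean_space set" and G :: "'e \<Rightarrow> 'e \<Rightarrow> 'e \<Rightarrow> real" and E +
  fixes lam \<gamma> :: "'e \<Rightarrow> real"
  assumes dim3: "DIM('e) = 3"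
    and bracket01: "x \<in> U \<Longrightarrow> G x (lie_bracket (E 0) (E 1) x) (E 0 x) = 0"
    and bracket02: "x \<in> U \<Longrightarrow> G x (lie_bracket (E 0) (E 2) x) (E 0 x) = 0"
    and bracket12: "x \<in> U \<Longrightarrow> G x (lie_bracket (E 1) (E 2) x) (E 0 x) = 2"
    and ricci_diag: "x \<in> U \<Longrightarrow> i < 3 \<Longrightarrow> ricci G x (E i x) (E i x) = lam x + (if i = 0 then \<gamma> x else 0)"
    and ricci_off: "x \<in> U \<Longrightarrow> i < 3 \<Longrightarrow> j < 3 \<Longrightarrow> i \<noteq> j \<Longrightarrow> ricci G x (E i x) (E j x) = 0"
begin

lemma sum3: "(\<Sum>m<DIM('e). f m) = f 0 + f 1 + f (2::nat)"
  by (simp add: dim3 eval_nat_numeral)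

text \<open>With \<open>i = 0, 1, 2\<close>, the numbers \<open>w, s, t\<close> are \<open>\<omega>\<^sub>i = g(\<nabla>\<^bsub>e\<^sub>i\<^esub> e\<^sub>1, e\<^sub>2)\<close>. The shift in \<open>q\<close> removes the
  skew part \<open>- \<phi>\<close> of \<open>\<nabla>e\<^sub>0\<close>: it will turn out that \<open>\<nabla>\<^bsub>e\<^sub>1\<^esub> e\<^sub>0 = p e\<^sub>1 + (q - 1) e\<^sub>2\<close> and
  \<open>\<nabla>\<^bsub>e\<^sub>2\<^esub> e\<^sub>0 = (q + 1) e\<^sub>1 - p e\<^sub>2\<close>.\<close>

definition p where "p = conn 1 0 1"
definition q where "q x = conn 1 0 2 x + 1"
definition w where "w = conn 0 1 2"
definition s where "s = conn 1 1 2"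
definition t where "t = conn 2 1 2"

lemma smooth_pqwst: "smooth_on U p" "smooth_on U q" "smooth_on U w" "smooth_on U s" "smooth_on U t"
  unfolding p_def q_def w_def s_def t_def
  by (intro smooth_on_add open_U smooth_on_const conn_smooth; simp add: dim3)+

definition frame_curvature where "frame_curvature i j k l x = G x (curvature x (E i x) (E j x) (E k x)) (E l x)"

lemma frame_curvature_antisym:
  assumes "x \<in> U"
  shows "frame_curvature i j k l x = - frame_curvature j i k l x"
    "i < 3 \<Longrightarrow> j < 3 \<Longrightarrow> k < 3 \<Longrightarrow> l < 3 \<Longrightarrow> frame_curvature i j k l x = - frame_curvature i j l k x"
  unfolding frame_curvature_def using curvature_frame_antisym[OF assms, of i j k l]
  by (simp_all add: curvature_antisym[OF assms, of "E i x"] G_simps[OF assms] dim3)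

text \<open>In dimension three an off-diagonal component of the Ricci tensor is a single component of the
  curvature, and a diagonal one is the sum of two sectional curvatures, so the Ricci tensor can be
  solved for the curvature.\<close>

lemma curvature_from_ricci:
  assumes x: "x \<in> U"
  shows "frame_curvature 0 1 0 1 x = - (lam x + \<gamma> x) / 2" "frame_curvature 0 2 0 2 x = - (lam x + \<gamma> x) / 2"
    "frame_curvature 1 2 1 2 x = (\<gamma> x - lam x) / 2"
    "frame_curvature 0 1 0 2 x = 0" "frame_curvature 0 2 0 1 x = 0" "frame_curvature 1 2 0 1 x = 0" "frame_curvature 1 2 0 2 x = 0"
    "frame_curvature 0 1 1 2 x = 0" "frame_curvature 0 2 1 2 x = 0"
proof -
  have ric: "ricci G x (E i x) (E j x) = frame_curvature 0 i j 0 x + frame_curvature 1 i j 1 x + frame_curvature 2 i j 2 x" for i j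
    by (simp add: ricci_frame[OF x] sum3 frame_curvature_def)
  have z: "frame_curvature i i j k x = 0" "i < 3 \<Longrightarrow> j < 3 \<Longrightarrow> k < 3 \<Longrightarrow> frame_curvature i j k k x = 0" for i j k
    using frame_curvature_antisym(1)[OF x, of i i] frame_curvature_antisym(2)[OF x, of i j k k] by auto
  note a = frame_curvature_antisym(1)[OF x, of 1 0] frame_curvature_antisym(1)[OF x, of 2 0] frame_curvature_antisym(1)[OF x, of 2 1]
    frame_curvature_antisym(2)[OF x, of _ _ 1 0] frame_curvature_antisym(2)[OF x, of _ _ 2 0] frame_curvature_antisym(2)[OF x, of _ _ 2 1]
  have off: "frame_curvature 0 1 0 2 x = 0" "frame_curvature 0 2 0 1 x = 0" "frame_curvature 1 2 0 1 x = 0" "frame_curvature 1 2 0 2 x = 0"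
    "frame_curvature 0 1 1 2 x = 0" "frame_curvature 0 2 1 2 x = 0"
    using ricci_off[OF x, of 1 2] ricci_off[OF x, of 2 1] ricci_off[OF x, of 2 0]
      ricci_off[OF x, of 1 0] ricci_off[OF x, of 0 2] ricci_off[OF x, of 0 1]
    by (simp_all add: ric z a del: One_nat_def)
  have "frame_curvature 0 1 0 1 x + frame_curvature 0 2 0 2 x = - (lam x + \<gamma> x)"
    "frame_curvature 0 1 0 1 x + frame_curvature 1 2 1 2 x = - lam x" "frame_curvature 0 2 0 2 x + frame_curvature 1 2 1 2 x = - lam x"
    using ricci_diag[OF x, of 0] ricci_diag[OF x, of 1] ricci_diag[OF x, of 2]
    by (simp_all add: ric z a del: One_nat_def)
  then show "frame_curvature 0 1 0 1 x = - (lam x + \<gamma> x) / 2" "frame_curvature 0 2 0 2 x = - (lam x + \<gamma> x) / 2"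
    "frame_curvature 1 2 1 2 x = (\<gamma> x - lam x) / 2" by argo+
  show "frame_curvature 0 1 0 2 x = 0" "frame_curvature 0 2 0 1 x = 0" "frame_curvature 1 2 0 1 x = 0" "frame_curvature 1 2 0 2 x = 0"
    "frame_curvature 0 1 1 2 x = 0" "frame_curvature 0 2 1 2 x = 0" by (fact off)+
qed

lemma conn_values:
  assumes x: "x \<in> U"
  shows "i < 3 \<Longrightarrow> j < 3 \<Longrightarrow> conn i j j x = 0"
    "conn 0 0 1 x = 0" "conn 0 0 2 x = 0" "conn 0 1 0 x = 0" "conn 0 2 0 x = 0"
    "conn 1 0 1 x = p x" "conn 1 0 2 x = q x - 1" "conn 2 0 1 x = q x + 1"
    "conn 1 1 0 x = - p x" "conn 1 2 0 x = 1 - q x" "conn 2 1 0 x = - q x - 1"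
    "conn 0 1 2 x = w x" "conn 1 1 2 x = s x" "conn 2 1 2 x = t x"
    "conn 0 2 1 x = - w x" "conn 1 2 1 x = - s x" "conn 2 2 1 x = - t x"
    "conn 2 2 0 x = - conn 2 0 2 x"
proof -
  note anti = conn_antisym[OF x, unfolded dim3]
  show d: "i < 3 \<Longrightarrow> j < 3 \<Longrightarrow> conn i j j x = 0" for i j using anti[of i j j] by simp
  have br: "G x (lie_bracket (E i) (E j) x) (E 0 x) = conn i j 0 x - conn j i 0 x"
    if "i < 3" "j < 3" for i j
    using G_lie_bracket_frame[OF x] that dim3 by simp
  show "conn 0 1 0 x = 0" "conn 0 2 0 x = 0"
    using bracket01[OF x] bracket02[OF x] by (simp_all add: br d del: One_nat_def)
  then show "conn 0 0 1 x = 0" "conn 0 0 2 x = 0" using anti[of 0 0 1] anti[of 0 0 2] by simp_all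
  have "conn 1 2 0 x - conn 2 1 0 x = 2"
    using bracket12[OF x] br[of 1 2] by simp
  moreover have a: "conn 2 1 0 x = - conn 2 0 1 x" "conn 1 2 0 x = - conn 1 0 2 x"
    by (rule anti; simp)+
  ultimately show "conn 2 0 1 x = q x + 1" "conn 2 1 0 x = - q x - 1" "conn 1 2 0 x = 1 - q x"
    unfolding q_def by linarith+
  show "conn 1 1 0 x = - p x" "conn 0 2 1 x = - w x" "conn 1 2 1 x = - s x"
    "conn 2 2 1 x = - t x" "conn 2 2 0 x = - conn 2 0 2 x"
    unfolding p_def w_def s_def t_def by (rule anti; simp)+
qed (simp_all add: p_def q_def w_def s_def t_def del: One_nat_def)

lemma D_conn_cong:
  assumes "x \<in> U" "i < 3" "j < 3" "k < 3" "smooth_on U f" "\<And>y. y \<in> U \<Longrightarrow> conn i j k y = f y"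
  shows "D (conn i j k) x v = D f x v"
  by (rule D_cong[OF open_U assms(1) conn_smooth assms(6)]) (use assms dim3 in auto)

lemma D_conn_values:
  assumes x: "x \<in> U"
  shows "D (conn 0 0 1) x v = 0" "D (conn 0 0 2) x v = 0"
    "D (conn 1 0 1) x v = D p x v" "D (conn 1 0 2) x v = D q x v" "D (conn 2 0 1) x v = D q x v"
    "D (conn 0 1 2) x v = D w x v" "D (conn 1 1 2) x v = D s x v" "D (conn 2 1 2) x v = D t x v"
proof -
  have "D (conn 0 0 1) x v = D (\<lambda>_. 0) x v" "D (conn 0 0 2) x v = D (\<lambda>_. 0) x v"
    by (rule D_conn_cong[OF x]; simp add: smooth_on_const conn_values del: One_nat_def)+
  then show "D (conn 0 0 1) x v = 0" "D (conn 0 0 2) x v = 0" by simp_all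
  have "D (conn 1 0 2) x v = D (\<lambda>y. q y - 1) x v" "D (conn 2 0 1) x v = D (\<lambda>y. q y + 1) x v"
    by (rule D_conn_cong[OF x]; simp add: smooth_on_const smooth_on_diff smooth_on_add smooth_pqwst open_U conn_values del: One_nat_def)+
  then show "D (conn 1 0 2) x v = D q x v" "D (conn 2 0 1) x v = D q x v"
    by (simp_all add: D_diff[OF smooth_pqwst(2) smooth_on_const x] D_add[OF smooth_pqwst(2) smooth_on_const x])
qed (simp_all add: p_def w_def s_def t_def del: One_nat_def)

text \<open>The field \<open>e\<^sub>0\<close> is divergence free. As the Ricci tensor is diagonal, \<open>R\<^sub>0\<^sub>1\<^sub>0\<^sub>2\<close> and \<open>R\<^sub>0\<^sub>2\<^sub>0\<^sub>1\<close> both vanish;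
  their difference is a multiple of the divergence \<open>p + g(\<nabla>\<^bsub>e\<^sub>2\<^esub> e\<^sub>0, e\<^sub>2)\<close>.\<close>

lemma conn_202:
  assumes x: "x \<in> U"
  shows "conn 2 0 2 x = - p x"
  using curvature_from_ricci(4,5)[OF x]
  by (simp add: frame_curvature_def curvature_frame[OF x] dim3 sum3[unfolded dim3] conn_values[OF x] D_conn_values[OF x] algebra_simps del: One_nat_def)

lemma D_conn_202: "x \<in> U \<Longrightarrow> D (conn 2 0 2) x v = - D p x v"
proof -
  assume x: "x \<in> U"
  have "D (conn 2 0 2) x v = D (\<lambda>y. 0 - p y) x v"
    by (rule D_conn_cong[OF x])
       (simp_all only: conn_202, simp_all add: smooth_on_diff[OF open_U smooth_on_const smooth_pqwst(1), of 0, simplified])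
  then show ?thesis by (simp add: D_diff[OF smooth_on_const smooth_pqwst(1) x, of 0, simplified])
qed

text \<open>The first and the third equation are the difference and the sum of those for \<open>R\<^sub>0\<^sub>1\<^sub>0\<^sub>1\<close> and
  \<open>R\<^sub>0\<^sub>2\<^sub>0\<^sub>2\<close>, the last one is that for \<open>R\<^sub>1\<^sub>2\<^sub>1\<^sub>2\<close>, and the others say that mixed components of the
  curvature vanish.\<close>

lemma structure_equations:
  assumes x: "x \<in> U"
  shows "D p x (E 0 x) = 2 * q x * w x" "D q x (E 0 x) = - 2 * p x * w x"
    "(lam x + \<gamma> x) / 2 = 1 - (p x)\<^sup>2 - (q x)\<^sup>2"
    "D q x (E 1 x) - D p x (E 2 x) = - 2 * (p x * s x + q x * t x)"
    "D p x (E 1 x) + D q x (E 2 x) = 2 * (q x * s x - p x * t x)"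
    "D s x (E 0 x) = D w x (E 1 x) - p x * s x + (w x - q x + 1) * t x"
    "D t x (E 0 x) = D w x (E 2 x) - (w x + q x + 1) * s x + p x * t x"
    "(\<gamma> x - lam x) / 2 = D t x (E 1 x) - D s x (E 2 x) + 1 - (p x)\<^sup>2 - (q x)\<^sup>2 - 2 * w x + (s x)\<^sup>2 + (t x)\<^sup>2"
  using curvature_from_ricci[OF x]
  by (simp_all add: frame_curvature_def curvature_frame[OF x] dim3 sum3[unfolded dim3] conn_values[OF x] D_conn_values[OF x]
     conn_202[OF x] D_conn_202[OF x] algebra_simps power2_eq_square del: One_nat_def) argo+

end

section \<open>Integrability conditions and their consequences\<close>

context eta_einstein_frame
begin

lemma frame_diff: "i < 3 \<Longrightarrow> x \<in> U \<Longrightarrow> E i differentiable at x"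
  using E_diff dim3 by simp

lemma frame_smooth: "i < 3 \<Longrightarrow> smooth_on U (E i)"
  using E_smooth dim3 by simp

lemma frame_commutators:
  fixes f :: "'e \<Rightarrow> real"
  assumes x: "x \<in> U" and f: "smooth_on U f"
  shows "D (\<lambda>y. D f y (E 1 y)) x (E 0 x) = D (\<lambda>y. D f y (E 0 y)) x (E 1 x)
      - p x * D f x (E 1 x) + (w x - q x + 1) * D f x (E 2 x)"
    "D (\<lambda>y. D f y (E 2 y)) x (E 0 x) = D (\<lambda>y. D f y (E 0 y)) x (E 2 x)
      - (w x + q x + 1) * D f x (E 1 x) + p x * D f x (E 2 x)"
    "D (\<lambda>y. D f y (E 2 y)) x (E 1 x) = D (\<lambda>y. D f y (E 1 y)) x (E 2 x)
      + 2 * D f x (E 0 x) - s x * D f x (E 1 x) - t x * D f x (E 2 x)"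
proof -
  note L = linear_frechet_derivative[OF smooth_on_differentiable[OF f x]]
  have br: "lie_bracket (E i) (E j) x = (conn i j 0 x - conn j i 0 x) *\<^sub>R E 0 x +
      (conn i j 1 x - conn j i 1 x) *\<^sub>R E 1 x + (conn i j 2 x - conn j i 2 x) *\<^sub>R E 2 x"
    if "i < 3" "j < 3" for i j
    unfolding lie_bracket_frame[OF x that[folded dim3]] sum3 ..
  have c: "D (\<lambda>y. D f y (E j y)) x (E i x) = D (\<lambda>y. D f y (E i y)) x (E j x) +
      (conn i j 0 x - conn j i 0 x) * D f x (E 0 x) +
      (conn i j 1 x - conn j i 1 x) * D f x (E 1 x) + (conn i j 2 x - conn j i 2 x) * D f x (E 2 x)"
    if "i < 3" "j < 3" for i j
    using directional_commutator[OF open_U x f frame_smooth[OF that(1)] frame_smooth[OF that(2)]]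
    by (simp add: br[OF that] linear_add[OF L] linear_scale[OF L] del: One_nat_def)
  show "D (\<lambda>y. D f y (E 1 y)) x (E 0 x) = D (\<lambda>y. D f y (E 0 y)) x (E 1 x)
      - p x * D f x (E 1 x) + (w x - q x + 1) * D f x (E 2 x)"
    "D (\<lambda>y. D f y (E 2 y)) x (E 0 x) = D (\<lambda>y. D f y (E 0 y)) x (E 2 x)
      - (w x + q x + 1) * D f x (E 1 x) + p x * D f x (E 2 x)"
    "D (\<lambda>y. D f y (E 2 y)) x (E 1 x) = D (\<lambda>y. D f y (E 1 y)) x (E 2 x)
      + 2 * D f x (E 0 x) - s x * D f x (E 1 x) - t x * D f x (E 2 x)"
    using c[of 0 1] c[of 0 2] c[of 1 2]
    by (simp_all add: conn_values[OF x] conn_202[OF x] algebra_simps del: One_nat_def)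
qed

lemma smooth_frame_deriv: "i < 3 \<Longrightarrow> smooth_on U f \<Longrightarrow> smooth_on U (\<lambda>y. D f y (E i y))"
  by (intro smooth_on_directional open_U frame_smooth)

lemma D_scaled_product:
  fixes f g :: "'e \<Rightarrow> real"
  assumes "x \<in> U" "smooth_on U f" "smooth_on U g"
  shows "D (\<lambda>y. c * f y * g y) x v = c * (D f x v * g x + f x * D g x v)"
proof -
  have "smooth_on U (\<lambda>y. f y * g y)" by (intro smooth_on_mult open_U assms)
  from D_mult[OF smooth_on_const[of _ c] this assms(1)] D_mult[OF assms(2,3,1)]
  show ?thesis by (simp add: mult.assoc)
qed

text \<open>In complex form, \<open>dz = - 2 i \<omega> z\<close> for \<open>z = p + i q\<close>. Along \<open>e\<^sub>0\<close> this is part of the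
  structure equations; along \<open>e\<^sub>1\<close> and \<open>e\<^sub>2\<close> it is the integrability condition of the
  structure equations.\<close>

lemma eigenvalue_derivatives:
  assumes x: "x \<in> U" and nz: "(p x)\<^sup>2 + (q x)\<^sup>2 \<noteq> 0"
  shows "D p x (E 1 x) = 2 * q x * s x" "D p x (E 2 x) = 2 * q x * t x"
    "D q x (E 1 x) = - 2 * p x * s x" "D q x (E 2 x) = - 2 * p x * t x"
proof -
  note sm = smooth_pqwst and se = structure_equations
  have dp0: "D (\<lambda>y. D p y (E 0 y)) x v = 2 * (D q x v * w x + q x * D w x v)" for v
  proof -
    have "D (\<lambda>y. D p y (E 0 y)) x v = D (\<lambda>y. 2 * q y * w y) x v"
      by (rule D_cong[OF open_U x]) (simp_all add: smooth_frame_deriv sm se)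
    then show ?thesis by (simp only: D_scaled_product[OF x sm(2,3)])
  qed
  have dq0: "D (\<lambda>y. D q y (E 0 y)) x v = - 2 * (D p x v * w x + p x * D w x v)" for v
  proof -
    have "D (\<lambda>y. D q y (E 0 y)) x v = D (\<lambda>y. - 2 * p y * w y) x v"
      by (rule D_cong[OF open_U x]) (simp_all add: smooth_frame_deriv sm se)
    then show ?thesis by (simp only: D_scaled_product[OF x sm(1,3)])
  qed
  have prod: "smooth_on U (\<lambda>y. c * f y * g y)" if "smooth_on U f" "smooth_on U g" for c and f g :: "'e \<Rightarrow> real"
    by (intro smooth_on_mult open_U smooth_on_const that)
  have d1: "D (\<lambda>y. D q y (E 1 y)) x v - D (\<lambda>y. D p y (E 2 y)) x v =
      - 2 * (D p x v * s x + p x * D s x v + D q x v * t x + q x * D t x v)" for v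
  proof -
    have "D (\<lambda>y. D q y (E 1 y)) x v - D (\<lambda>y. D p y (E 2 y)) x v = D (\<lambda>y. D q y (E 1 y) - D p y (E 2 y)) x v"
      by (rule D_diff[symmetric, OF smooth_frame_deriv smooth_frame_deriv x]) (simp_all add: sm)
    also have "\<dots> = D (\<lambda>y. - 2 * p y * s y + - 2 * q y * t y) x v"
      by (rule D_cong[OF open_U x])
         (simp_all add: smooth_on_diff open_U smooth_frame_deriv sm se(4) del: One_nat_def)
    also have "\<dots> = - 2 * (D p x v * s x + p x * D s x v) + - 2 * (D q x v * t x + q x * D t x v)"
      unfolding D_add[OF prod prod x, OF sm(1,4,2,5)]
        D_scaled_product[OF x sm(1,4)] D_scaled_product[OF x sm(2,5)] ..
    finally show ?thesis by simp
  qed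
  have d2: "D (\<lambda>y. D p y (E 1 y)) x v + D (\<lambda>y. D q y (E 2 y)) x v =
      2 * (D q x v * s x + q x * D s x v - D p x v * t x - p x * D t x v)" for v
  proof -
    have "D (\<lambda>y. D p y (E 1 y)) x v + D (\<lambda>y. D q y (E 2 y)) x v = D (\<lambda>y. D p y (E 1 y) + D q y (E 2 y)) x v"
      by (rule D_add[symmetric, OF smooth_frame_deriv smooth_frame_deriv x]) (simp_all add: sm)
    also have "\<dots> = D (\<lambda>y. 2 * q y * s y + - 2 * p y * t y) x v"
      by (rule D_cong[OF open_U x])
         (simp_all add: smooth_on_add open_U smooth_frame_deriv sm se(5) del: One_nat_def)
    also have "\<dots> = 2 * (D q x v * s x + q x * D s x v) + - 2 * (D p x v * t x + p x * D t x v)"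
      unfolding D_add[OF prod prod x, OF sm(2,4,1,5)]
        D_scaled_product[OF x sm(2,4)] D_scaled_product[OF x sm(1,5)] ..
    finally show ?thesis by simp
  qed
  note c = frame_commutators(1,2)[OF x sm(1), unfolded dp0] frame_commutators(1,2)[OF x sm(2), unfolded dq0]
  show "D p x (E 1 x) = 2 * q x * s x" "D p x (E 2 x) = 2 * q x * t x"
    "D q x (E 1 x) = - 2 * p x * s x" "D q x (E 2 x) = - 2 * p x * t x"
    using eigenvalue_integrability[OF se(1,2,4-7)[OF x] c d1 d2 nz] by blast+
qed

lemma open_nonzero: "open {x \<in> U. (p x)\<^sup>2 + (q x)\<^sup>2 \<noteq> 0}"
proof -
  have "continuous_on U (\<lambda>x. (p x)\<^sup>2 + (q x)\<^sup>2)"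
    by (intro continuous_intros smooth_on_continuous smooth_pqwst)
  from continuous_open_preimage[OF this open_U, of "- {0}"]
  show ?thesis by (simp add: vimage_def Int_def open_Compl)
qed

text \<open>Applying the commutator of \<open>e\<^sub>1\<close> and \<open>e\<^sub>2\<close> to \<open>p\<close> and \<open>q\<close> shows that \<open>d\<omega>(e\<^sub>1, e\<^sub>2) = 0\<close>. By
  the third and the last structure equation \<open>lam = - d\<omega>(e\<^sub>1, e\<^sub>2)\<close>.\<close>

lemma lam_zero:
  assumes x: "x \<in> U" and nz: "(p x)\<^sup>2 + (q x)\<^sup>2 \<noteq> 0"
  shows "lam x = 0"
proof -
  let ?V = "{x \<in> U. (p x)\<^sup>2 + (q x)\<^sup>2 \<noteq> 0}"
  note sm = smooth_pqwst and se = structure_equations[OF x] and ed = eigenvalue_derivatives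
  have xV: "x \<in> ?V" using x nz by simp
  \<comment> \<open>The formulas for the derivatives of \<open>p\<close> and \<open>q\<close> hold near \<open>x\<close> and may be differentiated.\<close>
  have loc: "D (\<lambda>y. D f y (E i y)) x v = c * (D g x v * h x + g x * D h x v)"
    if "i < 3" "smooth_on U f" "smooth_on U g" "smooth_on U h"
      "\<And>y. y \<in> U \<Longrightarrow> (p y)\<^sup>2 + (q y)\<^sup>2 \<noteq> 0 \<Longrightarrow> D f y (E i y) = c * g y * h y"
    for i c v and f g h :: "'e \<Rightarrow> real"
  proof -
    have "D (\<lambda>y. D f y (E i y)) x v = D (\<lambda>y. c * g y * h y) x v"
      by (rule D_cong[OF open_nonzero xV smooth_on_subset[OF smooth_frame_deriv]])
         (use that in auto)
    then show ?thesis by (simp only: D_scaled_product[OF x that(3,4)])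
  qed
  \<comment> \<open>This is \<open>d\<omega>(e\<^sub>1, e\<^sub>2)\<close>, as \<open>[e\<^sub>1, e\<^sub>2] = 2 e\<^sub>0 - s e\<^sub>1 - t e\<^sub>2\<close>.\<close>
  define Z where "Z = D t x (E 1 x) - D s x (E 2 x) - 2 * w x + (s x)\<^sup>2 + (t x)\<^sup>2"
  have "2 * (D q x (E 1 x) * t x + q x * D t x (E 1 x)) = 2 * (D q x (E 2 x) * s x + q x * D s x (E 2 x))
      + 2 * D p x (E 0 x) - s x * D p x (E 1 x) - t x * D p x (E 2 x)"
    using frame_commutators(3)[OF x sm(1)] loc[OF _ sm(1,2,4) ed(1), of "E 2 x"]
      loc[OF _ sm(1,2,5) ed(2), of "E 1 x"] by simp
  then have "q x * Z = 0"
    unfolding ed[OF x nz] se(1) Z_def by algebra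
  have "- 2 * (D p x (E 1 x) * t x + p x * D t x (E 1 x)) = - 2 * (D p x (E 2 x) * s x + p x * D s x (E 2 x))
      + 2 * D q x (E 0 x) - s x * D q x (E 1 x) - t x * D q x (E 2 x)"
    using frame_commutators(3)[OF x sm(2)] loc[OF _ sm(2,1,4) ed(3), of "E 2 x"]
      loc[OF _ sm(2,1,5) ed(4), of "E 1 x"] by simp
  then have "p x * Z = 0"
    unfolding ed[OF x nz] se(2) Z_def by algebra
  with \<open>q x * Z = 0\<close> nz have "Z = 0" by auto
  with se(3,8) show ?thesis unfolding Z_def by argo
qed

text \<open>By \<open>eigenvalue_derivatives\<close> the derivative of \<open>p\<^sup>2 + q\<^sup>2\<close> vanishes near \<open>x\<close>, and the structure equations
  express \<open>lam + \<gamma>\<close> through this function.\<close>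

lemma locally_constant:
  assumes x: "x \<in> U" and nz: "(p x)\<^sup>2 + (q x)\<^sup>2 \<noteq> 0"
  shows "\<exists>V. open V \<and> x \<in> V \<and> V \<subseteq> U \<and> (\<forall>y\<in>V. lam y = 0 \<and> lam y + \<gamma> y = lam x + \<gamma> x)"
proof -
  obtain r where r: "r > 0" "ball x r \<subseteq> {x \<in> U. (p x)\<^sup>2 + (q x)\<^sup>2 \<noteq> 0}"
    using open_nonzero x nz unfolding open_contains_ball by blast
  let ?f = "\<lambda>y. p y * p y + q y * q y"
  have sm: "smooth_on U ?f" by (intro smooth_on_add smooth_on_mult open_U smooth_pqwst)
  have zero: "D ?f y v = 0" if y: "y \<in> ball x r" for y v
  proof -
    from that r have yU: "y \<in> U" and nz: "(p y)\<^sup>2 + (q y)\<^sup>2 \<noteq> 0" by auto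
    have sm2: "smooth_on U (\<lambda>y. p y * p y)" "smooth_on U (\<lambda>y. q y * q y)"
      by (intro smooth_on_mult open_U smooth_pqwst)+
    have "D ?f y (E i y) = 0" if "i < 3" for i
    proof -
      have "i = 0 \<or> i = 1 \<or> i = 2" using that by auto
      then show ?thesis
        unfolding D_add[OF sm2 yU] D_mult[OF smooth_pqwst(1) smooth_pqwst(1) yU]
          D_mult[OF smooth_pqwst(2) smooth_pqwst(2) yU]
        using eigenvalue_derivatives[OF yU nz] structure_equations(1,2)[OF yU]
        by (auto simp del: One_nat_def)
    qed
    moreover note L = linear_frechet_derivative[OF smooth_on_differentiable[OF sm yU]]
    have "D ?f y v = D ?f y (\<Sum>i<DIM('e). G y v (E i y) *\<^sub>R E i y)"
      by (simp only: frame_expansion[OF yU])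
    ultimately show ?thesis
      by (simp add: linear_sum[OF L] linear_scale[OF L] dim3)
  qed
  have "(?f has_derivative (\<lambda>_. 0)) (at y within ball x r)" if "y \<in> ball x r" for y
  proof (rule has_derivative_at_withinI)
    have "y \<in> U" using that r by auto
    then show "(?f has_derivative (\<lambda>_. 0)) (at y)"
      using smooth_on_has_derivative[OF sm, of y] by (simp only: zero[OF that])
  qed
  from has_derivative_zero_constant[OF convex_ball this]
  obtain c where "?f y = c" if "y \<in> ball x r" for y by blast
  with r(1) have const: "?f y = ?f x" if "y \<in> ball x r" for y
    using that by (metis centre_in_ball)
  show ?thesis
  proof (intro exI[of _ "ball x r"] conjI ballI)
    fix y assume y: "y \<in> ball x r"
    with r(2) have yU: "y \<in> U" and nz: "(p y)\<^sup>2 + (q y)\<^sup>2 \<noteq> 0" by auto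
    show "lam y = 0" by (rule lam_zero[OF yU nz])
    show "lam y + \<gamma> y = lam x + \<gamma> x"
      using structure_equations(3)[OF x] structure_equations(3)[OF yU] const[OF y]
      unfolding power2_eq_square by argo
  qed (use r in auto)
qed

lemma dim3_pos: "0 < DIM('e)"
  by (simp add: dim3)

text \<open>When \<open>p\<close> and \<open>q\<close> vanish, only the skew part of \<open>\<nabla>e\<^sub>0\<close> is left.\<close>

lemma killing_at:
  assumes x: "x \<in> U" and z: "(p x)\<^sup>2 + (q x)\<^sup>2 = 0" and XY: "X differentiable at x" "Y differentiable at x"
  shows "lie_deriv_metric (E 0) G X Y x = 0"
proof -
  have pq: "p x = 0" "q x = 0" using z by (simp_all add: sum_power2_eq_zero_iff)
  have *: "G x (levi_civita G X (E 0) x) u =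
      G x (X x) (E 2 x) * G x u (E 1 x) - G x (X x) (E 1 x) * G x u (E 2 x)"
    if "X differentiable at x" for X u
    by (simp add: levi_civita_frame[OF x that] dim3_pos parseval[OF x, of "levi_civita G (E _) (E 0) x"] sum3 G_simps[OF x] conn_def[symmetric] conn_values[OF x] conn_202[OF x] pq del: One_nat_def)
  show ?thesis
    unfolding lie_deriv_metric_eq[OF x frame_diff[OF _ x] XY, of 0, simplified]
    using *[OF XY(1)] *[OF XY(2)] G_sym[OF x, of "X x" "levi_civita G Y (E 0) x"] by simp
qed

lemma half_ricci_E0_eq_one_iff: "x \<in> U \<Longrightarrow> (lam x + \<gamma> x) / 2 = 1 \<longleftrightarrow> (p x)\<^sup>2 + (q x)\<^sup>2 = 0"
  using structure_equations(3)[of x] by argo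

end

section \<open>Contact metric structures in a chart\<close>

text \<open>The coordinate representation of a contact metric structure whose Ricci operator has the prescribed
  form. The equation for \<open>d\<eta>\<close> is required for constant fields only, and extends to all fields because
  both sides are tensorial.\<close>

locale local_contact = local_metric S G
  for S :: "'e::euclidean_space set" and G :: "'e \<Rightarrow> 'e \<Rightarrow> 'e \<Rightarrow> real" +
  fixes H :: "'e \<Rightarrow> 'e \<Rightarrow> real" and \<Xi> :: "'e \<Rightarrow> 'e" and F :: "'e \<Rightarrow> 'e \<Rightarrow> 'e"
    and lam \<gamma> :: "'e \<Rightarrow> real"
  assumes dimension: "DIM('e) = 3"
    and H_linear: "x \<in> S \<Longrightarrow> linear (H x)" and H_smooth: "smooth_on S (\<lambda>x. H x u)"
    and F_linear: "x \<in> S \<Longrightarrow> linear (F x)" and F_smooth: "smooth_on S (\<lambda>x. F x u)"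
    and \<Xi>_smooth: "smooth_on S \<Xi>"
    and F_F: "x \<in> S \<Longrightarrow> F x (F x u) = - u + H x u *\<^sub>R \<Xi> x"
    and F_\<Xi>: "x \<in> S \<Longrightarrow> F x (\<Xi> x) = 0"
    and G_\<Xi>: "x \<in> S \<Longrightarrow> G x (\<Xi> x) (\<Xi> x) = 1"
    and dH: "x \<in> S \<Longrightarrow> ext_deriv H (\<lambda>_. u) (\<lambda>_. v) x = 2 * G x u (F x v)"
    and ricci_op_eq: "x \<in> S \<Longrightarrow> ricci_op G x u = lam x *\<^sub>R u + (\<gamma> x * H x u) *\<^sub>R \<Xi> x"
begin

lemma dH_fields:
  assumes x: "x \<in> S" and X: "X differentiable at x" and Y: "Y differentiable at x"
  shows "ext_deriv H X Y x = 2 * G x (X x) (F x (Y x))"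
proof -
  have der: "D (\<lambda>y. H y (P y)) x v = D (\<lambda>y. H y (P x)) x v + H x (D P x v)"
    if "P differentiable at x" for P v
    by (rule D_eqI[OF D_apply[OF open_U x H_linear smooth_on_differentiable[OF H_smooth x] that]])
  show ?thesis
    using dH[OF x, of "X x" "Y x"]
    by (simp add: ext_deriv_def lie_bracket_def der[OF X] der[OF Y] linear_diff[OF H_linear[OF x]]
        linear_0[OF H_linear[OF x]])
qed

lemma G_F_skew:
  assumes x: "x \<in> S"
  shows "G x u (F x v) = - G x (F x u) v"
proof -
  have "2 * G x u (F x v) = - (2 * G x v (F x u))"
    unfolding dH[OF x, symmetric]
    by (simp add: ext_deriv_def lie_bracket_def linear_0[OF H_linear[OF x]])
  then show ?thesis by (simp add: G_sym[OF x, of v])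
qed

text \<open>The endomorphism \<open>\<phi>\<close> is skew and annihilates \<open>\<xi>\<close>, so \<open>\<xi>\<close> is orthogonal to \<open>\<phi>\<^sup>2 u = - u + \<eta>(u) \<xi>\<close>.\<close>

lemma H_eq_G:
  assumes x: "x \<in> S"
  shows "H x u = G x (\<Xi> x) u"
proof -
  have "G x (\<Xi> x) (F x (F x u)) = 0"
    by (simp add: G_F_skew[OF x] F_\<Xi>[OF x] linear_0[OF F_linear[OF x]] G_simps[OF x])
  then show ?thesis by (simp add: F_F[OF x] G_simps[OF x] G_\<Xi>[OF x])
qed

text \<open>A constant vector \<open>w\<close> that is not a multiple of \<open>\<xi>\<close> at \<open>x0\<close> is projected to the kernel of \<open>\<eta>\<close> and
  normalised; this gives \<open>e\<^sub>1\<close> near \<open>x0\<close>. Then \<open>e\<^sub>2 = \<phi> e\<^sub>1\<close> is a unit vector orthogonal to \<open>\<xi>\<close> and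
  \<open>e\<^sub>1\<close>, as \<open>\<phi>\<close> is skew and \<open>\<phi>\<^sup>2 e\<^sub>1 = - e\<^sub>1\<close>.\<close>

lemma local_frame:
  assumes x0: "x0 \<in> S"
  obtains U E where "U \<subseteq> S" "x0 \<in> U" "E 0 = \<Xi>" "eta_einstein_frame U G E lam \<gamma>"
proof -
  have "\<exists>w. w \<noteq> H x0 w *\<^sub>R \<Xi> x0"
  proof (rule ccontr)
    assume "\<not> ?thesis"
    then have "w \<in> span {\<Xi> x0}" for w
      by (metis span_base span_scale singletonI)
    then have "dim (UNIV :: 'e set) \<le> card {\<Xi> x0}" by (intro dim_le_card) auto
    then show False using dimension by (simp add: dim_UNIV)
  qed
  then obtain w where w: "w - H x0 w *\<^sub>R \<Xi> x0 \<noteq> 0" by auto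
  define W where "W y = w - H y w *\<^sub>R \<Xi> y" for y
  define U where "U = {y \<in> S. W y \<noteq> 0}"
  have W_smooth: "smooth_on S W"
    unfolding W_def by (intro smooth_on_diff smooth_on_scaleR smooth_on_const open_U H_smooth \<Xi>_smooth)
  have US: "U \<subseteq> S" and x0U: "x0 \<in> U" using w x0 by (auto simp: U_def W_def)
  have oU: "open U"
    using continuous_open_preimage[OF smooth_on_continuous[OF W_smooth] open_U, of "- {0}"]
    by (simp add: U_def vimage_def Int_def open_Compl)
  interpret U: local_metric U G
    by (rule local_metric.intro[OF oU])
       (use US G_linear1 G_sym G_pos smooth_on_subset[OF G_smooth US] in blast)+
  define N where "N y = G y (W y) (W y)" for y
  have N_pos: "N y > 0" if "y \<in> U" for y using that G_pos by (auto simp: U_def N_def)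
  have N_smooth: "smooth_on U N"
    unfolding N_def
    by (rule smooth_on_apply[OF oU U.G_linear2 _ smooth_on_subset[OF W_smooth US]],
        assumption, rule smooth_on_apply[OF oU U.G_linear1 U.G_smooth smooth_on_subset[OF W_smooth US]])
  define e1 where "e1 y = inverse (sqrt (N y)) *\<^sub>R W y" for y
  define E where "E i = (if i = 0 then \<Xi> else if i = 1 then e1 else (\<lambda>y. F y (e1 y)))" for i :: nat
  have E_simps: "E 0 = \<Xi>" "E 1 = e1" "E 2 = (\<lambda>y. F y (e1 y))"
    by (simp_all add: E_def)
  have e1_smooth: "smooth_on U e1"
    unfolding e1_def
    by (intro smooth_on_scaleR oU smooth_on_inverse_sqrt N_smooth smooth_on_subset[OF W_smooth US] N_pos)
  have e2_smooth: "smooth_on U (\<lambda>y. F y (e1 y))"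
    by (rule smooth_on_apply[OF oU F_linear smooth_on_subset[OF F_smooth US] e1_smooth]) (use US in auto)
  have E_smooth: "smooth_on U (E i)" for i
    unfolding E_def using e1_smooth e2_smooth smooth_on_subset[OF \<Xi>_smooth US] by simp
  have He1: "H y (e1 y) = 0" if y: "y \<in> U" for y
    using that US G_\<Xi>[of y]
    by (auto simp: e1_def W_def H_eq_G G_simps)
  have He2: "H y (F y u) = 0" if y: "y \<in> U" for y u
    using that US by (auto simp: H_eq_G G_F_skew F_\<Xi> G_simps linear_0[OF F_linear])
  have e11: "G y (e1 y) (e1 y) = 1" if y: "y \<in> U" for y
  proof -
    have "G y (e1 y) (e1 y) = inverse (sqrt (N y)) * (inverse (sqrt (N y)) * N y)"
      using y by (simp add: e1_def N_def U.G_simps)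
    also have "\<dots> = 1" using N_pos[OF y] by (simp add: field_simps)
    finally show ?thesis .
  qed
  have FFe1: "F y (F y (e1 y)) = - e1 y" if y: "y \<in> U" for y
    using F_F[of y] He1[OF y] y US by auto
  have e12: "G y (e1 y) (F y (e1 y)) = 0" if y: "y \<in> U" for y
    using G_F_skew[of y "e1 y" "e1 y"] G_sym[of y "e1 y"] y US by force
  have e22: "G y (F y (e1 y)) (F y (e1 y)) = 1" if y: "y \<in> U" for y
    using G_F_skew[of y "e1 y" "F y (e1 y)"] FFe1[OF y] e11[OF y] y US by (force simp: U.G_simps)
  have orth: "G y (E i y) (E j y) = (if i = j then 1 else 0)" if y: "y \<in> U" and ij: "i < 3" "j < 3" for y i j
  proof -
    have yS: "y \<in> S" using y US by auto
    have z: "G y (\<Xi> y) (e1 y) = 0" "G y (e1 y) (\<Xi> y) = 0" "G y (\<Xi> y) (F y (e1 y)) = 0"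
      "G y (F y (e1 y)) (\<Xi> y) = 0" "G y (F y (e1 y)) (e1 y) = 0"
      using He1[OF y] He2[OF y, of "e1 y"] e12[OF y] by (simp_all add: H_eq_G[OF yS] G_sym[OF yS])
    have "i = 0 \<or> i = 1 \<or> i = 2" "j = 0 \<or> j = 1 \<or> j = 2" using ij by auto
    then show ?thesis
      by (elim disjE) (simp_all add: E_simps G_\<Xi>[OF yS] e11[OF y] e12[OF y] e22[OF y] z del: One_nat_def)
  qed
  interpret U: metric_frame U G E
    by unfold_locales (use E_smooth orth dimension in auto)
  have HE: "H y (E i y) = (if i = 0 then 1 else 0)" if y: "y \<in> U" and "i < 3" for y i
    using orth[OF y _ that(2), of 0] y US by (auto simp: H_eq_G E_def)
  have bracket: "G x (lie_bracket (E i) (E j) x) (E 0 x) = - 2 * G x (E i x) (F x (E j x))"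
    if x: "x \<in> U" and ij: "i < 3" "j < 3" for x i j
  proof -
    have xS: "x \<in> S" using x US by auto
    have z: "D (\<lambda>y. H y (E i y)) x v = 0" if "i < 3" for i v
    proof -
      have "D (\<lambda>y. H y (E i y)) x v = D (\<lambda>y. if i = 0 then 1 else 0) x v"
        by (rule D_cong[OF oU x smooth_on_apply[OF oU H_linear smooth_on_subset[OF H_smooth US] E_smooth]])
           (use US HE that in auto)
      then show ?thesis by simp
    qed
    have "2 * G x (E i x) (F x (E j x)) = ext_deriv H (E i) (E j) x"
      by (rule dH_fields[OF xS, symmetric]) (use smooth_on_differentiable[OF E_smooth x] in auto)
    also have "\<dots> = - G x (lie_bracket (E i) (E j) x) (E 0 x)"
      by (simp add: ext_deriv_def z ij H_eq_G[OF xS] G_sym[OF xS, of "\<Xi> x"] E_simps)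
    finally show ?thesis by simp
  qed
  have ricci: "ricci G x (E i x) (E j x) =
      (if i = j then lam x else 0) + (if i = 0 \<and> j = 0 then \<gamma> x else 0)"
    if x: "x \<in> U" and ij: "i < 3" "j < 3" for x i j
  proof -
    have xS: "x \<in> S" using x US by auto
    have "ricci G x (E i x) (E j x) = lam x * G x (E i x) (E j x) + \<gamma> x * H x (E i x) * H x (E j x)"
      unfolding U.G_ricci_op[OF x, symmetric] ricci_op_eq[OF xS]
      by (simp add: U.G_simps[OF x] H_eq_G[OF xS])
    then show ?thesis using ij by (simp add: orth[OF x] HE[OF x])
  qed
  have "eta_einstein_frame U G E lam \<gamma>"
  proof unfold_locales
    fix x assume x: "x \<in> U"
    then have xS: "x \<in> S" using US by auto
    show "G x (lie_bracket (E 0) (E 1) x) (E 0 x) = 0" "G x (lie_bracket (E 0) (E 2) x) (E 0 x) = 0"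
      using bracket[OF x, of 0 1] bracket[OF x, of 0 2]
      by (simp_all add: E_simps(1) G_F_skew[OF xS] F_\<Xi>[OF xS] linear_0[OF F_linear[OF xS]] G_simps[OF xS] del: One_nat_def)
    show "G x (lie_bracket (E 1) (E 2) x) (E 0 x) = 2"
      using bracket[OF x, of 1 2]
      by (simp add: E_simps(2,3) FFe1[OF x] G_simps[OF xS] e11[OF x] del: One_nat_def)
    show "ricci G x (E i x) (E i x) = lam x + (if i = 0 then \<gamma> x else 0)" if "i < 3" for i
      using ricci[OF x that that] by simp
    show "ricci G x (E i x) (E j x) = 0" if "i < 3" "j < 3" "i \<noteq> j" for i j
      using ricci[OF x that(1,2)] that by simp
  qed (fact dimension)
  with that US x0U E_simps(1) show thesis by blast
qed

lemma lie_deriv_reeb_zero: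
  assumes x: "x \<in> S" "(lam x + \<gamma> x) / 2 = 1" and XY: "X differentiable at x" "Y differentiable at x"
  shows "lie_deriv_metric \<Xi> G X Y x = 0"
proof -
  obtain U E where "x \<in> U" "E 0 = \<Xi>" and E: "eta_einstein_frame U G E lam \<gamma>"
    using local_frame[OF x(1)] by metis
  interpret K: eta_einstein_frame U G E lam \<gamma> by (fact E)
  show ?thesis
    using K.killing_at[OF \<open>x \<in> U\<close> _ XY] K.half_ricci_E0_eq_one_iff[OF \<open>x \<in> U\<close>] x(2) \<open>E 0 = \<Xi>\<close> by simp
qed

lemma non_killing_rigidity:
  assumes x: "x \<in> S" "(lam x + \<gamma> x) / 2 \<noteq> 1"
  shows "\<exists>V. open V \<and> x \<in> V \<and> V \<subseteq> S \<and> (\<forall>y\<in>V. lam y = 0 \<and> lam y + \<gamma> y = lam x + \<gamma> x)"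
proof -
  obtain U E where U: "x \<in> U" "U \<subseteq> S" and E: "eta_einstein_frame U G E lam \<gamma>"
    using local_frame[OF x(1)] by metis
  interpret K: eta_einstein_frame U G E lam \<gamma> by (fact E)
  show ?thesis
    using K.locally_constant[OF U(1)] K.half_ricci_E0_eq_one_iff[OF U(1)] x(2) U(2) by (meson subset_trans)
qed

end

section \<open>From charts to the manifold\<close>

locale manifold =
  fixes T :: "'a topology" and A :: "('a, 'e::euclidean_space) chart set"
  assumes smooth_manifold: "smooth_manifold T A"
begin

lemma chart_dom_subset: "\<kappa> \<in> A \<Longrightarrow> chart_dom \<kappa> \<subseteq> topspace T"
  and chart_dom_openin: "\<kappa> \<in> A \<Longrightarrow> openin T (chart_dom \<kappa>)"
  and chart_img_open: "\<kappa> \<in> A \<Longrightarrow> open (chart_img \<kappa>)"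
  and chart_homeomorphic: "\<kappa> \<in> A \<Longrightarrow>
    homeomorphic_map (subtopology T (chart_dom \<kappa>)) (top_of_set (chart_img \<kappa>)) (chart_map \<kappa>)"
  and transition_smooth: "\<kappa> \<in> A \<Longrightarrow> \<kappa>' \<in> A \<Longrightarrow>
    smooth_on (chart_map \<kappa> ` (chart_dom \<kappa> \<inter> chart_dom \<kappa>')) (chart_map \<kappa>' \<circ> chart_inv \<kappa>)"
  using smooth_manifold unfolding smooth_manifold_def by blast+

lemma chart_exists: "p \<in> topspace T \<Longrightarrow> \<exists>\<kappa>\<in>A. p \<in> chart_dom \<kappa>"
  using smooth_manifold unfolding smooth_manifold_def by blast

lemma topspace_chart: "\<kappa> \<in> A \<Longrightarrow> topspace (subtopology T (chart_dom \<kappa>)) = chart_dom \<kappa>"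
  using chart_dom_subset[of \<kappa>] by auto

lemma chart_inj: "\<kappa> \<in> A \<Longrightarrow> inj_on (chart_map \<kappa>) (chart_dom \<kappa>)"
  using homeomorphic_imp_injective_map[OF chart_homeomorphic] topspace_chart by metis

lemma chart_inv_map: "\<kappa> \<in> A \<Longrightarrow> p \<in> chart_dom \<kappa> \<Longrightarrow> chart_inv \<kappa> (chart_map \<kappa> p) = p"
  unfolding chart_inv_def by (simp add: chart_inj)

lemma chart_map_inv: "x \<in> chart_img \<kappa> \<Longrightarrow> chart_map \<kappa> (chart_inv \<kappa> x) = x"
  unfolding chart_inv_def chart_img_def by (rule f_inv_into_f)

lemma chart_inv_dom: "x \<in> chart_img \<kappa> \<Longrightarrow> chart_inv \<kappa> x \<in> chart_dom \<kappa>"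
  unfolding chart_inv_def chart_img_def by (rule inv_into_into)

lemma chart_image_open:
  assumes "\<kappa> \<in> A" "openin T W" "W \<subseteq> chart_dom \<kappa>"
  shows "open (chart_map \<kappa> ` W)"
proof -
  have "openin (subtopology T (chart_dom \<kappa>)) W"
    using assms(2,3) by (metis inf.absorb1 openin_subtopology)
  then have "openin (top_of_set (chart_img \<kappa>)) (chart_map \<kappa> ` W)"
    using homeomorphic_imp_open_map[OF chart_homeomorphic[OF assms(1)]] unfolding open_map_def by blast
  then show ?thesis using chart_img_open[OF assms(1)] openin_open_eq by blast
qed

lemma chart_preimage_openin:
  assumes "\<kappa> \<in> A" "open V" "V \<subseteq> chart_img \<kappa>"
  shows "openin T {p \<in> chart_dom \<kappa>. chart_map \<kappa> p \<in> V}"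
proof -
  have "openin (top_of_set (chart_img \<kappa>)) V"
    using assms chart_img_open openin_open_eq by blast
  then have "openin (subtopology T (chart_dom \<kappa>)) {p \<in> topspace (subtopology T (chart_dom \<kappa>)). chart_map \<kappa> p \<in> V}"
    using homeomorphic_imp_continuous_map[OF chart_homeomorphic[OF assms(1)]] openin_continuous_map_preimage by blast
  then show ?thesis
    using topspace_chart[OF assms(1)] openin_trans_full[OF _ chart_dom_openin[OF assms(1)]] by metis
qed

lemma transition_deriv_self:
  assumes "\<kappa> \<in> A" "p \<in> chart_dom \<kappa>"
  shows "transition_deriv \<kappa> \<kappa> p w = w"
  unfolding transition_deriv_def
proof (rule D_eqI)
  show "(chart_map \<kappa> \<circ> chart_inv \<kappa> has_derivative (\<lambda>w. w)) (at (chart_map \<kappa> p))"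
    by (rule has_derivative_transform_within_open[OF has_derivative_ident chart_img_open[OF assms(1)]])
       (use assms in \<open>simp_all add: chart_img_def chart_map_inv[unfolded chart_img_def]\<close>)
qed

lemma transition_differentiable:
  assumes "\<kappa> \<in> A" "\<kappa>' \<in> A" "p \<in> chart_dom \<kappa>" "p \<in> chart_dom \<kappa>'"
  shows "(chart_map \<kappa>' \<circ> chart_inv \<kappa>) differentiable at (chart_map \<kappa> p)"
  by (rule smooth_on_differentiable[OF transition_smooth[OF assms(1,2)]]) (use assms in auto)

lemma transition_deriv_compose:
  assumes A: "\<kappa> \<in> A" "\<kappa>' \<in> A" "\<kappa>'' \<in> A"
    and p: "p \<in> chart_dom \<kappa>" "p \<in> chart_dom \<kappa>'" "p \<in> chart_dom \<kappa>''"
  shows "transition_deriv \<kappa>' \<kappa>'' p (transition_deriv \<kappa> \<kappa>' p w) = transition_deriv \<kappa> \<kappa>'' p w"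
proof -
  let ?x = "chart_map \<kappa> p" and ?f = "chart_map \<kappa>' \<circ> chart_inv \<kappa>" and ?g = "chart_map \<kappa>'' \<circ> chart_inv \<kappa>'"
  let ?O = "chart_map \<kappa> ` (chart_dom \<kappa> \<inter> chart_dom \<kappa>')"
  have fx: "?f ?x = chart_map \<kappa>' p" by (simp add: chart_inv_map A p)
  have df: "(?f has_derivative (\<lambda>v. transition_deriv \<kappa> \<kappa>' p v)) (at ?x)"
    unfolding transition_deriv_def
    using transition_differentiable[OF A(1,2) p(1,2)] frechet_derivative_works by blast
  have dg: "(?g has_derivative (\<lambda>v. transition_deriv \<kappa>' \<kappa>'' p v)) (at (?f ?x))"
    unfolding transition_deriv_def fx
    using transition_differentiable[OF A(2,3) p(2,3)] frechet_derivative_works by blast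
  have "(chart_map \<kappa>'' \<circ> chart_inv \<kappa> has_derivative
      (\<lambda>v. transition_deriv \<kappa>' \<kappa>'' p (transition_deriv \<kappa> \<kappa>' p v))) (at ?x)"
  proof (rule has_derivative_transform_within_open[OF has_derivative_compose[OF df dg]])
    show "open ?O"
      by (rule chart_image_open[OF A(1)]) (auto intro: openin_Int chart_dom_openin A)
    show "?x \<in> ?O" using p by auto
    show "?g (?f x) = (chart_map \<kappa>'' \<circ> chart_inv \<kappa>) x" if "x \<in> ?O" for x
      using that by (auto simp: chart_inv_map A)
  qed
  from D_eqI[OF this, of w] show ?thesis by (simp add: transition_deriv_def)
qed

lemma charts_atI: "\<kappa> \<in> A \<Longrightarrow> p \<in> chart_dom \<kappa> \<Longrightarrow> \<kappa> \<in> charts_at A p"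
  by (simp add: charts_at_def)

text \<open>The components of \<open>chart_vec\<close> in two other charts are related by the chain rule for transition
  maps.\<close>

lemma chart_vec_tangent:
  assumes "\<kappa> \<in> A" "p \<in> chart_dom \<kappa>"
  shows "chart_vec A \<kappa> p w \<in> tangent_space A p"
  using assms transition_deriv_compose by (auto simp: tangent_space_def chart_vec_def charts_at_def)

lemma chart_vec_self:
  assumes "\<kappa> \<in> A" "p \<in> chart_dom \<kappa>"
  shows "chart_vec A \<kappa> p w \<kappa> = w"
  using assms by (simp add: chart_vec_def charts_at_def transition_deriv_self)

lemma tangent_chart_vec:
  assumes "\<kappa> \<in> A" "p \<in> chart_dom \<kappa>" "v \<in> tangent_space A p"
  shows "chart_vec A \<kappa> p (v \<kappa>) = v"
proof
  fix \<kappa>'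
  show "chart_vec A \<kappa> p (v \<kappa>) \<kappa>' = v \<kappa>'"
  proof (cases "\<kappa>' \<in> charts_at A p")
    case True
    with assms(3) charts_atI[OF assms(1,2)] have "v \<kappa>' = transition_deriv \<kappa> \<kappa>' p (v \<kappa>)"
      unfolding tangent_space_def by blast
    with True show ?thesis unfolding chart_vec_def by presburger
  next
    case False
    with assms(3) have "v \<kappa>' = 0" unfolding tangent_space_def by blast
    with False show ?thesis by (simp add: chart_vec_def)
  qed
qed

lemma chart_vec_lincomb:
  assumes "\<kappa> \<in> A" "p \<in> chart_dom \<kappa>"
  shows "chart_vec A \<kappa> p (a *\<^sub>R u + b *\<^sub>R v) = tlincomb a (chart_vec A \<kappa> p u) b (chart_vec A \<kappa> p v)"
proof
  fix \<kappa>'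
  show "chart_vec A \<kappa> p (a *\<^sub>R u + b *\<^sub>R v) \<kappa>' = tlincomb a (chart_vec A \<kappa> p u) b (chart_vec A \<kappa> p v) \<kappa>'"
  proof (cases "\<kappa>' \<in> charts_at A p")
    case True
    then have "linear (\<lambda>v. transition_deriv \<kappa> \<kappa>' p v)"
      unfolding transition_deriv_def charts_at_def
      by (intro linear_frechet_derivative transition_differentiable assms) auto
    with True show ?thesis
      by (simp add: chart_vec_def tlincomb_def linear_add linear_scale)
  qed (simp add: chart_vec_def tlincomb_def)
qed

end

lemma linear_lincombI:
  assumes "\<And>a b u v. f (a *\<^sub>R u + b *\<^sub>R v) = a *\<^sub>R f u + b *\<^sub>R f v"
  shows "linear f"
proof (rule linearI)
  show "f (u + v) = f u + f v" for u v using assms[of 1 u 1 v] by simp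
  show "f (r *\<^sub>R u) = r *\<^sub>R f u" for r u using assms[of r u 0 0] by simp
qed

text \<open>Through \<open>chart_vec\<close> the tangent space at a point of a chart is linearly isomorphic to the coordinate
  space, and under this isomorphism each tensor of the structure becomes its representation.\<close>

lemma local_contact_chart:
  fixes A :: "('a, 'e::euclidean_space) chart set"
  assumes cms: "contact_metric_structure T A \<eta> \<xi> \<phi> g" and dim: "DIM('e) = 3" and \<kappa>: "\<kappa> \<in> A"
    and ric: "\<And>p v. p \<in> topspace T \<Longrightarrow> v \<in> tangent_space A p \<Longrightarrow>
      ricci_operator A g p v = tlincomb (lam p) v (\<gamma> p * \<eta> p v) (\<xi> p)"
  shows "local_contact (chart_img \<kappa>) (rep_metric A \<kappa> g) (rep_form A \<kappa> \<eta>) (rep_vec \<kappa> \<xi>)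
    (rep_endo A \<kappa> \<phi>) (lam \<circ> chart_inv \<kappa>) (\<gamma> \<circ> chart_inv \<kappa>)"
proof -
  interpret manifold T A
    using cms by (simp add: manifold_def contact_metric_structure_def)
  have form: "one_form T A \<eta>" and field: "vector_field T A \<xi>" and endo: "endo_field T A \<phi>"
    and metric: "riemannian_metric T A g"
    using cms by (auto simp: contact_metric_structure_def contact_form_def reeb_field_def)
  have dom: "chart_inv \<kappa> x \<in> chart_dom \<kappa>" "chart_inv \<kappa> x \<in> topspace T" if "x \<in> chart_img \<kappa>" for x
    using chart_inv_dom[OF that] chart_dom_subset[OF \<kappa>] by auto
  let ?cv = "\<lambda>x. chart_vec A \<kappa> (chart_inv \<kappa> x)"
  note lincomb = chart_vec_lincomb[OF \<kappa> dom(1)] and tangent = chart_vec_tangent[OF \<kappa> dom(1)]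
  have \<xi>_tangent: "\<xi> (chart_inv \<kappa> x) \<in> tangent_space A (chart_inv \<kappa> x)" if "x \<in> chart_img \<kappa>" for x
    using field dom(2)[OF that] by (simp add: vector_field_def)
  have cv_\<xi>: "?cv x (rep_vec \<kappa> \<xi> x) = \<xi> (chart_inv \<kappa> x)" if "x \<in> chart_img \<kappa>" for x
    unfolding rep_vec_def by (rule tangent_chart_vec[OF \<kappa> dom(1)[OF that] \<xi>_tangent[OF that]])
  have cv_\<phi>: "?cv x (rep_endo A \<kappa> \<phi> x u) = \<phi> (chart_inv \<kappa> x) (?cv x u)" if "x \<in> chart_img \<kappa>" for x u
    unfolding rep_endo_def using endo dom(2)[OF that] tangent[OF that]
    by (intro tangent_chart_vec[OF \<kappa> dom(1)[OF that]]) (auto simp: endo_field_def)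
  show ?thesis
  proof (intro local_contact.intro local_metric.intro local_contact_axioms.intro)
    fix x assume x: "x \<in> chart_img \<kappa>"
    note l = lincomb[OF x] and t = tangent[OF x] and p = dom(2)[OF x]
    show "linear (\<lambda>u. rep_metric A \<kappa> g x u w)" for w
      unfolding rep_metric_def using metric p t by (intro linear_lincombI) (auto simp: l riemannian_metric_def)
    show "rep_metric A \<kappa> g x u w = rep_metric A \<kappa> g x w u" for u w
      unfolding rep_metric_def using metric p t by (auto simp: riemannian_metric_def)
    show "rep_metric A \<kappa> g x u u > 0" if "u \<noteq> 0" for u
    proof -
      have "?cv x u \<noteq> (\<lambda>_. 0)" using chart_vec_self[OF \<kappa> dom(1)[OF x], of u] that by auto
      then show ?thesis
        unfolding rep_metric_def using metric p t by (auto simp: riemannian_metric_def)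
    qed
    show "linear (rep_form A \<kappa> \<eta> x)"
      unfolding rep_form_def using form p t by (intro linear_lincombI) (auto simp: l one_form_def)
    show "linear (rep_endo A \<kappa> \<phi> x)"
    proof (rule linear_lincombI)
      fix a b u v
      have "\<phi> (chart_inv \<kappa> x) (tlincomb a (?cv x u) b (?cv x v)) =
          tlincomb a (\<phi> (chart_inv \<kappa> x) (?cv x u)) b (\<phi> (chart_inv \<kappa> x) (?cv x v))"
        using endo p t by (auto simp: endo_field_def)
      then show "rep_endo A \<kappa> \<phi> x (a *\<^sub>R u + b *\<^sub>R v) = a *\<^sub>R rep_endo A \<kappa> \<phi> x u + b *\<^sub>R rep_endo A \<kappa> \<phi> x v"
        unfolding rep_endo_def l by (simp add: tlincomb_def)
    qed
    show "rep_endo A \<kappa> \<phi> x (rep_endo A \<kappa> \<phi> x u) = - u + rep_form A \<kappa> \<eta> x u *\<^sub>R rep_vec \<kappa> \<xi> x" for u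
    proof -
      have "rep_endo A \<kappa> \<phi> x (rep_endo A \<kappa> \<phi> x u) = \<phi> (chart_inv \<kappa> x) (\<phi> (chart_inv \<kappa> x) (?cv x u)) \<kappa>"
        by (simp only: rep_endo_def[of A \<kappa> \<phi> x "rep_endo A \<kappa> \<phi> x u"] cv_\<phi>[OF x])
      also have "\<phi> (chart_inv \<kappa> x) (\<phi> (chart_inv \<kappa> x) (?cv x u)) =
          tlincomb (- 1) (?cv x u) (\<eta> (chart_inv \<kappa> x) (?cv x u)) (\<xi> (chart_inv \<kappa> x))"
        using cms p t by (auto simp: contact_metric_structure_def)
      finally show ?thesis
        by (simp add: tlincomb_def chart_vec_self[OF \<kappa> dom(1)[OF x]] rep_form_def rep_vec_def)
    qed
    show "rep_endo A \<kappa> \<phi> x (rep_vec \<kappa> \<xi> x) = 0"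
      using cms p by (simp add: rep_endo_def cv_\<xi>[OF x] contact_metric_structure_def)
    show "rep_metric A \<kappa> g x (rep_vec \<kappa> \<xi> x) (rep_vec \<kappa> \<xi> x) = 1"
      using cms p by (simp add: rep_metric_def cv_\<xi>[OF x] contact_metric_structure_def)
    show "ext_deriv (rep_form A \<kappa> \<eta>) (\<lambda>_. u) (\<lambda>_. v) x = 2 * rep_metric A \<kappa> g x u (rep_endo A \<kappa> \<phi> x v)" for u v
    proof -
      have "\<forall>X Y. smooth_on (chart_img \<kappa>) X \<longrightarrow> smooth_on (chart_img \<kappa>) Y \<longrightarrow>
        (\<forall>x\<in>chart_img \<kappa>. ext_deriv (rep_form A \<kappa> \<eta>) X Y x =
           2 * rep_metric A \<kappa> g x (X x) (rep_endo A \<kappa> \<phi> x (Y x)))"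
        using cms \<kappa> unfolding contact_metric_structure_def by blast
      from this[rule_format, OF smooth_on_const smooth_on_const x] show ?thesis .
    qed
    show "ricci_op (rep_metric A \<kappa> g) x u =
        (lam \<circ> chart_inv \<kappa>) x *\<^sub>R u + ((\<gamma> \<circ> chart_inv \<kappa>) x * rep_form A \<kappa> \<eta> x u) *\<^sub>R rep_vec \<kappa> \<xi> x" for u
    proof -
      have "ricci_operator A g (chart_inv \<kappa> x) (?cv x u) \<kappa> = ricci_op (rep_metric A \<kappa> g) x u"
        by (simp add: ricci_operator_def charts_atI[OF \<kappa> dom(1)[OF x]] chart_map_inv[OF x]
            chart_vec_self[OF \<kappa> dom(1)[OF x]])
      then show ?thesis
        unfolding ric[OF p t]
        by (simp add: tlincomb_def chart_vec_self[OF \<kappa> dom(1)[OF x]] rep_form_def rep_vec_def)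
    qed
  next
    show "open (chart_img \<kappa>)" by (rule chart_img_open[OF \<kappa>])
    show "smooth_on (chart_img \<kappa>) (\<lambda>x. rep_metric A \<kappa> g x u w)" for u w
      using metric \<kappa> by (simp add: riemannian_metric_def)
    show "smooth_on (chart_img \<kappa>) (\<lambda>x. rep_form A \<kappa> \<eta> x u)" for u
      using form \<kappa> by (simp add: one_form_def)
    show "smooth_on (chart_img \<kappa>) (\<lambda>x. rep_endo A \<kappa> \<phi> x u)" for u
      using endo \<kappa> by (simp add: endo_field_def)
    show "smooth_on (chart_img \<kappa>) (rep_vec \<kappa> \<xi>)"
      using field \<kappa> by (simp add: vector_field_def)
  qed (fact dim)
qed

theorem corollary1:
  fixes T :: "'a topology"
    and A :: "('a, real^3) chart set"
    and \<eta> :: "'a \<Rightarrow> ('a, real^3) tangent \<Rightarrow> real"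
    and \<xi> :: "'a \<Rightarrow> ('a, real^3) tangent"
    and \<phi> :: "'a \<Rightarrow> ('a, real^3) tangent \<Rightarrow> ('a, real^3) tangent"
    and g :: "'a \<Rightarrow> ('a, real^3) tangent \<Rightarrow> ('a, real^3) tangent \<Rightarrow> real"
  assumes "contact_metric_structure T A \<eta> \<xi> \<phi> g"
    and "strict_generalized_eta_einstein T A \<eta> \<xi> g"
  shows "K_contact T A \<eta> \<xi> \<phi> g"
proof -
  obtain lam \<gamma> where smooth: "smooth_function A lam" "smooth_function A \<gamma>"
    and strict: "\<not> (lam constant_on topspace T \<and> \<gamma> constant_on topspace T)"
    and ric: "\<And>p v. p \<in> topspace T \<Longrightarrow> v \<in> tangent_space A p \<Longrightarrow>
      ricci_operator A g p v = tlincomb (lam p) v (\<gamma> p * \<eta> p v) (\<xi> p)"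
    using assms(2) unfolding strict_generalized_eta_einstein_def by blast
  interpret manifold T A
    using assms(1) by (simp add: manifold_def contact_metric_structure_def)
  have loc: "local_contact (chart_img \<kappa>) (rep_metric A \<kappa> g) (rep_form A \<kappa> \<eta>) (rep_vec \<kappa> \<xi>)
      (rep_endo A \<kappa> \<phi>) (lam \<circ> chart_inv \<kappa>) (\<gamma> \<circ> chart_inv \<kappa>)" if "\<kappa> \<in> A" for \<kappa>
    by (rule local_contact_chart[OF assms(1) _ that ric]) auto
  define k where "k p = lam p + \<gamma> p" for p
  have rigid: "\<exists>W. openin T W \<and> p \<in> W \<and> (\<forall>p'\<in>W. lam p' = 0 \<and> k p' = k p)"
    if p: "p \<in> topspace T" "k p \<noteq> 2" for p
  proof -
    obtain \<kappa> where \<kappa>: "\<kappa> \<in> A" "p \<in> chart_dom \<kappa>" using chart_exists[OF p(1)] by blast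
    let ?x = "chart_map \<kappa> p"
    have x: "?x \<in> chart_img \<kappa>" using \<kappa> by (simp add: chart_img_def)
    have "((lam \<circ> chart_inv \<kappa>) ?x + (\<gamma> \<circ> chart_inv \<kappa>) ?x) / 2 \<noteq> 1"
      using p(2) by (simp add: chart_inv_map[OF \<kappa>] k_def)
    from local_contact.non_killing_rigidity[OF loc[OF \<kappa>(1)] x this]
    obtain V where V: "open V" "?x \<in> V" "V \<subseteq> chart_img \<kappa>"
      "\<And>y. y \<in> V \<Longrightarrow> lam (chart_inv \<kappa> y) = 0 \<and> k (chart_inv \<kappa> y) = k p"
      by (auto simp: chart_inv_map[OF \<kappa>] k_def)
    show ?thesis
      using chart_preimage_openin[OF \<kappa>(1) V(1,3)] V(2) \<kappa> V(4)
      by (intro exI[of _ "{p \<in> chart_dom \<kappa>. chart_map \<kappa> p \<in> V}"]) (auto, (metis chart_inv_map)+)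
  qed
  \<comment> \<open>The level sets of \<open>k\<close> are closed, by continuity.\<close>
  have ne_open: "openin T {p \<in> topspace T. k p \<noteq> c}" for c
  proof (subst openin_subopen, intro ballI)
    fix p assume "p \<in> {p \<in> topspace T. k p \<noteq> c}"
    then have p: "p \<in> topspace T" "k p \<noteq> c" by auto
    obtain \<kappa> where \<kappa>: "\<kappa> \<in> A" "p \<in> chart_dom \<kappa>" using chart_exists[OF p(1)] by blast
    let ?f = "\<lambda>x. (lam \<circ> chart_inv \<kappa>) x + (\<gamma> \<circ> chart_inv \<kappa>) x"
    let ?V = "{x \<in> chart_img \<kappa>. ?f x \<noteq> c}"
    have "continuous_on (chart_img \<kappa>) ?f"
      using smooth \<kappa>(1) by (intro continuous_on_add smooth_on_continuous) (simp_all add: smooth_function_def comp_def)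
    from continuous_open_preimage[OF this chart_img_open[OF \<kappa>(1)], of "- {c}"]
    have "open ?V" by (simp add: vimage_def Int_def open_Compl)
    then have "openin T {p \<in> chart_dom \<kappa>. chart_map \<kappa> p \<in> ?V}"
      by (intro chart_preimage_openin[OF \<kappa>(1)]) auto
    moreover have "{p \<in> chart_dom \<kappa>. chart_map \<kappa> p \<in> ?V} = {p \<in> chart_dom \<kappa>. k p \<noteq> c}"
    proof -
      have "chart_map \<kappa> p \<in> ?V \<longleftrightarrow> k p \<noteq> c" if "p \<in> chart_dom \<kappa>" for p
        using imageI[OF that, of "chart_map \<kappa>"] chart_inv_map[OF \<kappa>(1) that]
        by (simp add: k_def chart_img_def)
      then show ?thesis by blast
    qed
    ultimately show "\<exists>W. openin T W \<and> p \<in> W \<and> W \<subseteq> {p \<in> topspace T. k p \<noteq> c}"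
      using \<kappa> p chart_dom_subset[OF \<kappa>(1)]
      by (intro exI[of _ "{p \<in> chart_dom \<kappa>. k p \<noteq> c}"]) auto
  qed
  have k2: "k p = 2" if p: "p \<in> topspace T" for p
  proof (rule ccontr)
    assume kp: "k p \<noteq> 2"
    let ?C = "{p' \<in> topspace T. k p' = k p}"
    have "openin T ?C"
    proof (subst openin_subopen, intro ballI)
      fix p' assume "p' \<in> ?C"
      with kp rigid[of p'] obtain W where "openin T W" "p' \<in> W" "\<forall>p''\<in>W. k p'' = k p" by auto
      then show "\<exists>W. openin T W \<and> p' \<in> W \<and> W \<subseteq> ?C"
        using openin_subset by (intro exI[of _ W]) blast
    qed
    moreover have "closedin T ?C"
      unfolding closedin_def using ne_open[of "k p"] by (auto simp: set_diff_eq elim!: back_subst[of "openin T"])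
    moreover have "connected_space T"
      using smooth_manifold by (simp add: smooth_manifold_def)
    ultimately have "?C = topspace T"
      using p unfolding connected_space_clopen_in by blast
    then have "k p' = k p" if "p' \<in> topspace T" for p' using that by blast
    moreover from this have "lam p' = 0" if "p' \<in> topspace T" for p'
      using rigid[OF that] kp that by metis
    ultimately have "lam p' = 0" "\<gamma> p' = k p" if "p' \<in> topspace T" for p'
      using that by (force simp: k_def)+
    with strict show False unfolding constant_on_def by blast
  qed
  have "killing_field T A g \<xi>"
    unfolding killing_field_def
  proof (intro conjI ballI allI impI)
    show "vector_field T A \<xi>"
      using assms(1) by (simp add: contact_metric_structure_def reeb_field_def)
    fix \<kappa> x and X Y :: "real^3 \<Rightarrow> real^3"
    assume \<kappa>: "\<kappa> \<in> A" and XY: "smooth_on (chart_img \<kappa>) X" "smooth_on (chart_img \<kappa>) Y" and x: "x \<in> chart_img \<kappa>"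
    have "chart_inv \<kappa> x \<in> topspace T"
      using chart_inv_dom[OF x] chart_dom_subset[OF \<kappa>] by blast
    from k2[OF this] have "((lam \<circ> chart_inv \<kappa>) x + (\<gamma> \<circ> chart_inv \<kappa>) x) / 2 = 1"
      by (simp add: k_def)
    then show "lie_deriv_metric (rep_vec \<kappa> \<xi>) (rep_metric A \<kappa> g) X Y x = 0"
      by (rule local_contact.lie_deriv_reeb_zero[OF loc[OF \<kappa>] x _ XY[THEN smooth_on_differentiable[OF _ x]]])
  qed
  with assms(1) show ?thesis by (simp add: K_contact_def)
qed

end
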